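(* Let $\mu\in(1,2)$ be a rational number given as an irreducible fraction $\mu=c/d$, and let $0<\epsilon<1/4$. There is an algorithm which, given a positive integer $n$ and read-only access (on an input tape of infinite length) to a real number $x\in[0,1)$, outputs a bit sequence $\mathbf{b}_n\in\mathcal{L}_n(x,\epsilon)$, and whose space complexity is $\mathrm{O}(\lg^2\epsilon^{-1}\,\lg d/\lg^2\mu+\lg n)$.
   Context: $\lg$ denotes $\log_2$. The tent map $f=f_\mu\colon[0,1]\to[0,1]$ is $f(x)=\mu x$ for $x\le 1/2$ and $f(x)=\mu(1-x)$ for $x\ge 1/2$; $f^i$ is its $i$-fold iterate and $x_i=f^i(x)$. The tent code $\gamma^n(x)=b_1\cdots b_n\in\{0,1\}^n$ of $x\in[0,1)$ is defined by $b_1=0$ if $x<1/2$ and $b_1=1$ if $x\ge1/2$, and for $i\ge1$: $b_{i+1}=b_i$ if $x_i<1/2$, $b_{i+1}=\overline{b_i}$ (bit complement) if $x_i>1/2$, and $b_{i+1}=1$ if $x_i=1/2$. The tent language is $\mathcal{L}_n=\{\gamma^n(x): x\in[0,1)\}$. For $x\in[0,1)$ and $\epsilon>0$, $\mathcal{L}_n(x,\epsilon)=\{\gamma^n(x'): x-\epsilon\le x'\le x+\epsilon\}$. Space complexity is the working space of a Turing machine whose input real $x$ is given on a read-only tape (its infinite binary expansion) and whose output bits are written to a write-only output. *)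

theory Defs
  imports Complex_Main
begin

section \<open>Tent codes\<close>

definition tent :: "real \<Rightarrow> real \<Rightarrow> real" where
  "tent \<mu> x = (if x \<le> 1/2 then \<mu> * x else \<mu> * (1 - x))"

text \<open>Bits are booleans, and positions are counted from 0: \<open>tent_bit \<mu> x i\<close> is \<open>b\<^sub>i\<^sub>+\<^sub>1\<close>.\<close>

primrec tent_bit :: "real \<Rightarrow> real \<Rightarrow> nat \<Rightarrow> bool" where
  "tent_bit \<mu> x 0 = (x \<ge> 1/2)"
| "tent_bit \<mu> x (Suc i) =
     (let y = (tent \<mu> ^^ Suc i) x in
      if y < 1/2 then tent_bit \<mu> x i
      else if y > 1/2 then \<not> tent_bit \<mu> x i
      else True)"

definition tent_code :: "real \<Rightarrow> nat \<Rightarrow> real \<Rightarrow> bool list" where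
  "tent_code \<mu> n x = map (tent_bit \<mu> x) [0..<n]"

definition tent_language_near :: "real \<Rightarrow> nat \<Rightarrow> real \<Rightarrow> real \<Rightarrow> bool list set" where
  "tent_language_near \<mu> n x \<epsilon> =
     {tent_code \<mu> n x' | x'. x' \<in> {0..<1} \<and> x - \<epsilon> \<le> x' \<and> x' \<le> x + \<epsilon>}"


section \<open>Turing machines with read-only input tapes\<close>

text \<open>
  All tapes are one-way infinite, with cells numbered from 0; a left move on cell 0 has no effect.
  Cell 0 of an input tape carries the marker \<open>LeftEnd\<close>. The machine has one read-only input tape,
  with its own two-way head, for each port, a single read/write work tape, and a write-only output,
  to which a step appends at most one bit.
\<close>

datatype input_symbol = LeftEnd | Blank | Bit bool

datatype direction = GoLeft | Stay | GoRight

datatype port = Numerator | Denominator | Code_Length | Accuracy | Initial_Point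

fun move :: "direction \<Rightarrow> nat \<Rightarrow> nat" where
  "move GoLeft i = i - 1"
| "move Stay i = i"
| "move GoRight i = Suc i"

record ('q, 'a) tm =
  states :: "'q set"
  alphabet :: "'a set"
  start :: 'q
  final :: 'q
  blank :: 'a
  delta :: "'q \<Rightarrow> (port \<Rightarrow> input_symbol) \<Rightarrow> 'a \<Rightarrow>
    'q \<times> 'a \<times> direction \<times> (port \<Rightarrow> direction) \<times> bool option"

definition wf_tm :: "('q, 'a) tm \<Rightarrow> bool" where
  "wf_tm M \<longleftrightarrow>
     finite (states M) \<and> finite (alphabet M) \<and>
     start M \<in> states M \<and> final M \<in> states M \<and> blank M \<in> alphabet M \<and>
     (\<forall>q \<in> states M. \<forall>r. \<forall>a \<in> alphabet M.
        fst (delta M q r a) \<in> states M \<and> fst (snd (delta M q r a)) \<in> alphabet M)"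

record ('q, 'a) config =
  state :: 'q
  work :: "nat \<Rightarrow> 'a"
  work_head :: nat
  input_head :: "port \<Rightarrow> nat"
  emitted :: "bool list"

definition initial_config :: "('q, 'a) tm \<Rightarrow> ('q, 'a) config" where
  "initial_config M =
     \<lparr>state = start M, work = (\<lambda>_. blank M), work_head = 0, input_head = (\<lambda>_. 0), emitted = []\<rparr>"

definition step ::
  "('q, 'a) tm \<Rightarrow> (port \<Rightarrow> nat \<Rightarrow> input_symbol) \<Rightarrow> ('q, 'a) config \<Rightarrow> ('q, 'a) config" where
  "step M I C =
     (if state C = final M then C
      else case delta M (state C) (\<lambda>p. I p (input_head C p)) (work C (work_head C)) of
        (q, a, m, ms, e) \<Rightarrow>
          \<lparr>state = q,
           work = (work C)(work_head C := a),
           work_head = move m (work_head C),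
           input_head = (\<lambda>p. move (ms p) (input_head C p)),
           emitted = emitted C @ (case e of None \<Rightarrow> [] | Some b \<Rightarrow> [b])\<rparr>)"

definition run ::
  "('q, 'a) tm \<Rightarrow> (port \<Rightarrow> nat \<Rightarrow> input_symbol) \<Rightarrow> nat \<Rightarrow> ('q, 'a) config" where
  "run M I t = (step M I ^^ t) (initial_config M)"

text \<open>
  The work head starts on cell 0 and moves by at most one cell per step, so the first conjunct of
  the space condition bounds the number of work cells visited. The second conjunct charges for the
  addresses of the input cells being read. Without it the heads on the infinite input tapes would be
  free unbounded counters, and two such counters can already replace all of the work tape.
\<close>

definition outputs_in_space ::
  "('q, 'a) tm \<Rightarrow> (port \<Rightarrow> nat \<Rightarrow> input_symbol) \<Rightarrow> bool list \<Rightarrow> real \<Rightarrow> bool" where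
  "outputs_in_space M I bs s \<longleftrightarrow>
     (\<exists>t. state (run M I t) = final M \<and> emitted (run M I t) = bs) \<and>
     (\<forall>t. real (Suc (work_head (run M I t))) \<le> s \<and>
          (\<forall>p. log 2 (1 + real (input_head (run M I t) p)) \<le> s))"


section \<open>Encoding of the inputs\<close>

text \<open>Most significant bit first, without leading zeros.\<close>

fun binary_word :: "nat \<Rightarrow> bool list" where
  "binary_word n = (if n = 0 then [] else binary_word (n div 2) @ [odd n])"

declare binary_word.simps [simp del]

definition word_tape :: "bool list \<Rightarrow> nat \<Rightarrow> input_symbol" where
  "word_tape w i =
     (case i of 0 \<Rightarrow> LeftEnd | Suc j \<Rightarrow> if j < length w then Bit (w ! j) else Blank)"

definition stream_tape :: "(nat \<Rightarrow> bool) \<Rightarrow> nat \<Rightarrow> input_symbol" where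
  "stream_tape b i = (case i of 0 \<Rightarrow> LeftEnd | Suc j \<Rightarrow> Bit (b j))"

text \<open>A dyadic rational in \<open>(0,1)\<close> has two binary expansions; both are admitted.\<close>

definition binary_expansion :: "real \<Rightarrow> (nat \<Rightarrow> bool) \<Rightarrow> bool" where
  "binary_expansion x b \<longleftrightarrow> (\<lambda>i. of_bool (b i) / 2 ^ Suc i) sums x"

fun input_tapes ::
  "nat \<Rightarrow> nat \<Rightarrow> nat \<Rightarrow> (nat \<Rightarrow> bool) \<Rightarrow> (nat \<Rightarrow> bool) \<Rightarrow> port \<Rightarrow> nat \<Rightarrow> input_symbol" where
  "input_tapes c d n eb xb Numerator = word_tape (binary_word c)"
| "input_tapes c d n eb xb Denominator = word_tape (binary_word d)"
| "input_tapes c d n eb xb Code_Length = word_tape (binary_word n)"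
| "input_tapes c d n eb xb Accuracy = stream_tape eb"
| "input_tapes c d n eb xb Initial_Point = stream_tape xb"

end

theory Submission
  imports Defs
begin

text \<open>
  Read \<open>q\<close> bits of \<open>x\<close>, where \<open>2\<^sup>-\<^sup>q \<le> \<epsilon>\<close>, and follow the image of the corresponding dyadic interval under the
  iterated tent map exactly, with its endpoints as fractions. While the image does not contain the critical
  point \<open>1/2\<close> in its interior, the next bit is forced and the length grows by the factor \<open>\<mu>\<close>. When it does,
  the walk may continue with any subinterval that ends at \<open>1/2\<close>; since both sides of \<open>1/2\<close> are folded
  together, only its length \<open>\<delta>\<close> matters. The walk keeps the current \<open>\<delta>\<close> if one of the two halves is at least
  that long, and is then periodic from there on. Otherwise it takes the half that ends at
  \<open>f\<^sup>r(1/2)\<close>, where \<open>r\<close> is the number of steps since the last cut. In that case \<open>\<mu>\<^sup>r < 2\<close>, the new length is at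
  least \<open>(\<mu>\<^sup>r - 1) \<delta>\<close>, and \<open>r\<close> exceeds all earlier values. Hence the denominators stay below \<open>2\<^sup>q d\<^sup>e\<close> with
  \<open>e = O(1/ln\<^sup>2 \<mu> + q/ln \<mu>)\<close>, because the product of \<open>\<mu>\<^sup>j - 1\<close> over \<open>j \<le> r\<close> is at least
  \<open>r! ln\<^sup>r \<mu> \<ge> exp (-1/ln \<mu>)\<close>.

  Running time is irrelevant, so the walk is programmed with counters. A Turing machine stores the counters in
  binary, in space proportional to the logarithm of the largest value.
\<close>

section \<open>Counter programs on Turing machines\<close>

text \<open>Exact arithmetic alone is too costly: each step multiplies the denominator by
  \<open>d\<close>. A cut lets the walk forget, since a restarted segment is described by its length
  alone. The half ending at the critical orbit is preferred because \<delta> is then the distance of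
  \<open>f^r(1/2)\<close> from 1/2. The shorter segment maps into the images of the longer one, so
  it is not cut before time \<open>r\<close>; at time \<open>r\<close> one end lies at distance
  exactly \<delta>, which keeps \<delta>. Hence a further change needs a larger return time. When
  both halves are shorter than \<delta>, the whole width \<open>\<mu>^r \<delta>\<close> is below
  \<open>2 \<delta>\<close>, and subtracting the other half gives the lower bound for the new
  length. The exponent \<open>e\<close> has two sources: the sum of the distinct return times with
  \<open>\<mu>^r < 2\<close>, of order \<open>1/ln^2 \<mu>\<close>, and the time since the last cut
  or the start, which is logarithmic in the inverse of the length because no width exceeds
  1.\<close>

datatype 'v cond = Pos 'v | Sees port "input_symbol set"

datatype 'v com =
    Skip
  | Inc 'v
  | Dec 'v
  | Emit bool
  | Shift port direction
  | Seq "'v com" "'v com"  (infixr ";;" 60)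
  | IfElse "'v cond" "'v com" "'v com"
  | While "'v cond" "'v com"

type_synonym 'v store = "('v \<Rightarrow> nat) \<times> (port \<Rightarrow> nat) \<times> bool list"

fun holds :: "(port \<Rightarrow> nat \<Rightarrow> input_symbol) \<Rightarrow> 'v cond \<Rightarrow> 'v store \<Rightarrow> bool" where
  "holds I (Pos v) (s, hs, out) \<longleftrightarrow> 0 < s v"
| "holds I (Sees p S) (s, hs, out) \<longleftrightarrow> I p (hs p) \<in> S"

text \<open>The bound \<open>N\<close> is checked at every increment and every head move, so a
  derivation also certifies the space used. \<open>Dec\<close> has no rule at zero, where the
  machine would run along the blank track forever.\<close>

inductive big :: "nat \<Rightarrow> (port \<Rightarrow> nat \<Rightarrow> input_symbol) \<Rightarrow> 'v com \<Rightarrow> 'v store \<Rightarrow> 'v store \<Rightarrow> bool"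
  for N I where
  Skip: "big N I Skip x x"
| Inc: "s v < N \<Longrightarrow> big N I (Inc v) (s, hs, out) (s(v := Suc (s v)), hs, out)"
| Dec: "0 < s v \<Longrightarrow> big N I (Dec v) (s, hs, out) (s(v := s v - 1), hs, out)"
| Emit: "big N I (Emit b) (s, hs, out) (s, hs, out @ [b])"
| Shift: "move m (hs p) \<le> N \<Longrightarrow>
    big N I (Shift p m) (s, hs, out) (s, hs(p := move m (hs p)), out)"
| Seq: "big N I c\<^sub>1 x y \<Longrightarrow> big N I c\<^sub>2 y z \<Longrightarrow> big N I (c\<^sub>1 ;; c\<^sub>2) x z"
| IfTrue: "holds I b x \<Longrightarrow> big N I c\<^sub>1 x y \<Longrightarrow> big N I (IfElse b c\<^sub>1 c\<^sub>2) x y"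
| IfFalse: "\<not> holds I b x \<Longrightarrow> big N I c\<^sub>2 x y \<Longrightarrow> big N I (IfElse b c\<^sub>1 c\<^sub>2) x y"
| WhileTrue: "holds I b x \<Longrightarrow> big N I c x y \<Longrightarrow> big N I (While b c) y z \<Longrightarrow> big N I (While b c) x z"
| WhileFalse: "\<not> holds I b x \<Longrightarrow> big N I (While b c) x x"

text \<open>
  The control state is the stack of commands still to be executed; \<open>Rewind\<close> first returns the work
  head to the marked cell 0. Every register occupies one track of the work tape, least
  significant bit in cell 0.
\<close>

datatype 'v control = Boot "'v com" | Fetch "'v com list" | Rewind "'v com list"

text \<open>The boolean marks cell 0. \<open>None\<close> lies beyond the end of a register's word,
  so that a carry or a search for a nonzero bit can tell where the number ends.\<close>

type_synonym 'v cell = "bool \<times> ('v \<Rightarrow> bool option)"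

type_synonym 'v action =
  "'v control \<times> 'v cell \<times> direction \<times> (port \<Rightarrow> direction) \<times> bool option"

abbreviation act :: "'v control \<Rightarrow> 'v cell \<Rightarrow> direction \<Rightarrow> 'v action" where
  "act q x m \<equiv> (q, x, m, \<lambda>_. Stay, None)"

text \<open>The result \<open>None\<close> means that the scan for a nonzero bit has to go on.\<close>

fun probe :: "'v cond \<Rightarrow> (port \<Rightarrow> input_symbol) \<Rightarrow> ('v \<Rightarrow> bool option) \<Rightarrow> bool option" where
  "probe (Pos v) r a = (case a v of None \<Rightarrow> Some False | Some True \<Rightarrow> Some True | Some False \<Rightarrow> None)"
| "probe (Sees p S) r a = Some (r p \<in> S)"

text \<open>A command that scans its track stays on top of the stack while the head moves right and
  is popped only at the end of the scan, so scans need no control states of their own.\<close>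

fun transition :: "'v control \<Rightarrow> (port \<Rightarrow> input_symbol) \<Rightarrow> 'v cell \<Rightarrow> 'v action" where
  "transition (Boot c) r (m, a) = act (Fetch [c]) (True, a) Stay"
| "transition (Rewind k) r (m, a) =
     (if m then act (Fetch k) (m, a) Stay else act (Rewind k) (m, a) GoLeft)"
| "transition (Fetch []) r (m, a) = act (Fetch []) (m, a) Stay"
| "transition (Fetch (Skip # k)) r (m, a) = act (Fetch k) (m, a) Stay"
| "transition (Fetch (Inc v # k)) r (m, a) =
     (if a v = Some True then act (Fetch (Inc v # k)) (m, a(v := Some False)) GoRight
      else act (Rewind k) (m, a(v := Some True)) Stay)"
| "transition (Fetch (Dec v # k)) r (m, a) =
     (if a v = Some True then act (Rewind k) (m, a(v := Some False)) Stay
      else act (Fetch (Dec v # k)) (m, a(v := Some True)) GoRight)"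
| "transition (Fetch (Emit b # k)) r (m, a) = (Fetch k, (m, a), Stay, \<lambda>_. Stay, Some b)"
| "transition (Fetch (Shift p dir # k)) r (m, a) =
     (Fetch k, (m, a), Stay, (\<lambda>_. Stay)(p := dir), None)"
| "transition (Fetch ((c\<^sub>1 ;; c\<^sub>2) # k)) r (m, a) = act (Fetch (c\<^sub>1 # c\<^sub>2 # k)) (m, a) Stay"
| "transition (Fetch (IfElse b c\<^sub>1 c\<^sub>2 # k)) r (m, a) =
     (case probe b r a of
        None \<Rightarrow> act (Fetch (IfElse b c\<^sub>1 c\<^sub>2 # k)) (m, a) GoRight
      | Some t \<Rightarrow> act (Rewind ((if t then c\<^sub>1 else c\<^sub>2) # k)) (m, a) Stay)"
| "transition (Fetch (While b c # k)) r (m, a) =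
     (case probe b r a of
        None \<Rightarrow> act (Fetch (While b c # k)) (m, a) GoRight
      | Some t \<Rightarrow> act (Rewind (if t then c # While b c # k else k)) (m, a) Stay)"

fun cond_regs :: "'v cond \<Rightarrow> 'v set" where
  "cond_regs (Pos v) = {v}"
| "cond_regs (Sees p S) = {}"

fun regs :: "'v com \<Rightarrow> 'v set" where
  "regs (Inc v) = {v}"
| "regs (Dec v) = {v}"
| "regs (c\<^sub>1 ;; c\<^sub>2) = regs c\<^sub>1 \<union> regs c\<^sub>2"
| "regs (IfElse b c\<^sub>1 c\<^sub>2) = regs c\<^sub>1 \<union> regs c\<^sub>2"
| "regs (While b c) = regs c"
| "regs _ = {}"

text \<open>These are the stacks that can occur while \<open>c\<close> runs on top of
  \<open>k\<close>, before \<open>k\<close> itself is reached. The body of a loop runs on top of the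
  loop, which closes the set and keeps it finite.\<close>

fun stacks :: "'v com \<Rightarrow> 'v com list \<Rightarrow> 'v com list set" where
  "stacks (c\<^sub>1 ;; c\<^sub>2) k = insert ((c\<^sub>1 ;; c\<^sub>2) # k) (stacks c\<^sub>1 (c\<^sub>2 # k) \<union> stacks c\<^sub>2 k)"
| "stacks (IfElse b c\<^sub>1 c\<^sub>2) k = insert (IfElse b c\<^sub>1 c\<^sub>2 # k) (stacks c\<^sub>1 k \<union> stacks c\<^sub>2 k)"
| "stacks (While b c) k = insert (While b c # k) (stacks c (While b c # k))"
| "stacks c k = {c # k}"

text \<open>The register type may be infinite, as \<open>reg\<close> is below. Restricting the
  nonblank tracks to \<open>regs c\<close> keeps the alphabet finite.\<close>

definition machine :: "'v com \<Rightarrow> ('v control, 'v cell) tm" where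
  "machine c =
    \<lparr>states = insert (Boot c) ((Fetch ` insert [] (stacks c [])) \<union> (Rewind ` insert [] (stacks c []))),
     alphabet = UNIV \<times> {a. {v. a v \<noteq> None} \<subseteq> regs c},
     start = Boot c, final = Fetch [], blank = (False, \<lambda>_. None), delta = transition\<rparr>"

lemma finite_regs: "finite (regs c)"
  by (induction c) auto

lemma finite_stacks: "finite (stacks c k)"
  by (induction c arbitrary: k) auto

lemma stacks_self: "c # k \<in> stacks c k"
  by (cases c) auto

lemma finite_tracks:
  assumes "finite A"
  shows "finite {a :: 'v \<Rightarrow> bool option. {v. a v \<noteq> None} \<subseteq> A}"
proof -
  have "{a :: 'v \<Rightarrow> bool option. {v. a v \<noteq> None} \<subseteq> A}
      \<subseteq> {a. \<forall>v. (v \<in> A \<longrightarrow> a v \<in> UNIV) \<and> (v \<notin> A \<longrightarrow> a v = None)}"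
    by auto
  then show ?thesis
    by (rule finite_subset) (intro finite_set_of_finite_funs assms finite)
qed

text \<open>By induction on \<open>c\<close> for all \<open>k\<close>: a step inside a subcommand
  stays among its stacks or uncovers its continuation, and the latter is \<open>k\<close> or, by
  \<open>stacks_self\<close>, again a stack of \<open>c\<close>.\<close>

lemma transition_closed:
  assumes "q \<in> stacks c k"
    and "transition (Fetch q) r x = (q', x', rest)"
  shows "q' \<in> (Fetch ` insert k (stacks c k)) \<union> (Rewind ` insert k (stacks c k))"
    and "{v. snd x' v \<noteq> None} \<subseteq> {v. snd x v \<noteq> None} \<union> regs c"
proof -
  have "q' \<in> (Fetch ` insert k (stacks c k)) \<union> (Rewind ` insert k (stacks c k)) \<and>
        {v. snd x' v \<noteq> None} \<subseteq> {v. snd x v \<noteq> None} \<union> regs c"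
    using assms
  proof (induction c arbitrary: k)
    case (Seq c1 c2)
    from Seq.prems(1) consider "q = (c1 ;; c2) # k" | "q \<in> stacks c1 (c2 # k)" | "q \<in> stacks c2 k"
      by auto
    then show ?case
    proof cases
      case 1
      then show ?thesis using Seq.prems(2) by (cases x) (auto simp: stacks_self)
    next
      case 2
      then show ?thesis using Seq.IH(1)[OF 2 Seq.prems(2)] by (auto simp: stacks_self)
    next
      case 3
      then show ?thesis using Seq.IH(2)[OF 3 Seq.prems(2)] by (auto simp: stacks_self)
    qed
  next
    case (IfElse b c1 c2)
    from IfElse.prems(1) consider "q = IfElse b c1 c2 # k" | "q \<in> stacks c1 k" | "q \<in> stacks c2 k"
      by auto
    then show ?case
    proof cases
      case 1
      then show ?thesis using IfElse.prems(2) by (cases x) (auto simp: stacks_self split: option.splits if_splits)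
    next
      case 2
      then show ?thesis using IfElse.IH(1)[OF 2 IfElse.prems(2)] by (auto simp: stacks_self)
    next
      case 3
      then show ?thesis using IfElse.IH(2)[OF 3 IfElse.prems(2)] by (auto simp: stacks_self)
    qed
  next
    case (While b c)
    from While.prems(1) consider "q = While b c # k" | "q \<in> stacks c (While b c # k)"
      by auto
    then show ?case
    proof cases
      case 1
      then show ?thesis using While.prems(2) by (cases x) (auto simp: stacks_self split: option.splits if_splits)
    next
      case 2
      then show ?thesis using While.IH[OF 2 While.prems(2)] by (auto simp: stacks_self)
    qed
  qed (cases x; auto split: if_splits)+
  then show "q' \<in> (Fetch ` insert k (stacks c k)) \<union> (Rewind ` insert k (stacks c k))"
    and "{v. snd x' v \<noteq> None} \<subseteq> {v. snd x v \<noteq> None} \<union> regs c"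
    by auto
qed

lemma wf_machine: "wf_tm (machine c)"
proof -
  have "fst (transition q r x) \<in> states (machine c) \<and> fst (snd (transition q r x)) \<in> alphabet (machine c)"
    if q: "q \<in> states (machine c)" and x: "x \<in> alphabet (machine c)" for q r x
  proof -
    obtain m a where xa: "x = (m, a)" by (cases x)
    from q consider "q = Boot c" | "q = Fetch []" | k where "q = Fetch k" "k \<in> stacks c []"
      | k where "q = Rewind k" "k \<in> insert [] (stacks c [])"
      by (auto simp: machine_def)
    then show ?thesis
    proof cases
      case 3
      obtain q' x' rest where t: "transition (Fetch k) r x = (q', x', rest)"
        by (cases "transition (Fetch k) r x")
      have "{v. snd x' v \<noteq> None} \<subseteq> regs c"
        by (rule order_trans[OF transition_closed(2)[OF 3(2) t]]) (use x in \<open>auto simp: machine_def\<close>)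
      then show ?thesis
        using transition_closed(1)[OF 3(2) t] unfolding 3(1) t
        by (cases x') (auto simp: machine_def)
    qed (use x in \<open>auto simp: machine_def xa stacks_self\<close>)
  qed
  moreover have "finite (states (machine c))" "finite (alphabet (machine c))"
    by (auto simp: machine_def finite_stacks finite_tracks[OF finite_regs, simplified] intro!: finite_cartesian_product)
  ultimately show ?thesis
    by (auto simp: wf_tm_def machine_def)
qed

section \<open>Runs that stay within a space bound\<close>

inductive path :: "('q, 'a) tm \<Rightarrow> (port \<Rightarrow> nat \<Rightarrow> input_symbol) \<Rightarrow> (('q, 'a) config \<Rightarrow> bool) \<Rightarrow>
    ('q, 'a) config \<Rightarrow> ('q, 'a) config \<Rightarrow> bool"
  for M I P where
  path_refl: "P C \<Longrightarrow> path M I P C C"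
| path_step: "P C \<Longrightarrow> path M I P (step M I C) D \<Longrightarrow> path M I P C D"

lemma path_trans: "path M I P C D \<Longrightarrow> path M I P D E \<Longrightarrow> path M I P C E"
  by (induction rule: path.induct) (auto intro: path_step)

text \<open>A final configuration is fixed by \<open>step\<close>, so a finite path controls the run
  at all times, which is what \<open>outputs_in_space\<close> asks for.\<close>

lemma path_final:
  assumes "path M I P C D" "state D = final M"
  shows "(\<exists>t. (step M I ^^ t) C = D) \<and> (\<forall>t. P ((step M I ^^ t) C))"
  using assms
proof (induction rule: path.induct)
  case (path_refl C)
  then have "step M I C = C" by (simp add: step_def)
  then have "(step M I ^^ t) C = C" for t by (induction t) auto
  with path_refl show ?case by simp
next
  case (path_step C D)
  then obtain t where t: "(step M I ^^ t) (step M I C) = D" by blast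
  have "P ((step M I ^^ u) C)" for u
    using path_step by (cases u) (simp_all add: funpow_Suc_right del: funpow.simps)
  moreover have "(step M I ^^ Suc t) C = D"
    using t by (simp add: funpow_Suc_right del: funpow.simps)
  ultimately show ?case by blast
qed

section \<open>Binary counters on the tracks of the tape\<close>

fun val :: "bool list \<Rightarrow> nat" where
  "val [] = 0"
| "val (b # w) = of_bool b + 2 * val w"

fun inc :: "bool list \<Rightarrow> bool list" where
  "inc [] = [True]"
| "inc (False # w) = True # w"
| "inc (True # w) = False # inc w"

fun dec :: "bool list \<Rightarrow> bool list" where
  "dec [] = []"
| "dec (True # w) = False # w"
| "dec (False # w) = True # dec w"

lemma val_inc: "val (inc w) = Suc (val w)"
  by (induction w rule: inc.induct) auto

lemma val_dec: "0 < val w \<Longrightarrow> val (dec w) = val w - 1"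
  by (induction w rule: dec.induct) auto

lemma length_dec [simp]: "length (dec w) = length w"
  by (induction w rule: dec.induct) auto

text \<open>A word becomes longer only when all its bits are one. The new value then needs the extra
  cell, so a bound on register values bounds the length of the tracks.\<close>

lemma length_inc: "length (inc w) = length w \<or> 2 ^ length w \<le> val (inc w) \<and> length (inc w) = Suc (length w)"
  by (induction w rule: inc.induct) auto

fun track :: "(nat \<Rightarrow> 'v cell) \<Rightarrow> 'v \<Rightarrow> nat \<Rightarrow> bool list \<Rightarrow> bool" where
  "track T v p [] \<longleftrightarrow> (\<forall>i\<ge>p. snd (T i) v = None)"
| "track T v p (b # w) \<longleftrightarrow> snd (T p) v = Some b \<and> track T v (Suc p) w"

lemma track_cong: "(\<And>i. p \<le> i \<Longrightarrow> snd (T i) v = snd (T' i) v) \<Longrightarrow> track T v p w = track T' v p w"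
  by (induction w arbitrary: p) auto

text \<open>Words are not canonical: \<open>dec\<close> never shortens a track and may leave zeros
  at its most significant end. Hence only the length is bounded.\<close>

definition represents :: "nat \<Rightarrow> ('v \<Rightarrow> nat) \<Rightarrow> (nat \<Rightarrow> 'v cell) \<Rightarrow> bool" where
  "represents B s T \<longleftrightarrow> (\<forall>i. fst (T i) \<longleftrightarrow> i = 0) \<and>
     (\<forall>v. \<exists>w. length w \<le> B \<and> track T v 0 w \<and> val w = s v)"

definition cfg where
  "cfg q T h hs out = \<lparr>state = q, work = T, work_head = h, input_head = hs, emitted = out\<rparr>"

definition in_space :: "nat \<Rightarrow> nat \<Rightarrow> ('q, 'a) config \<Rightarrow> bool" where
  "in_space B N C \<longleftrightarrow> work_head C \<le> B \<and> (\<forall>p. input_head C p \<le> N)"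

lemma in_space_cfg [simp]: "in_space B N (cfg q T h hs out) \<longleftrightarrow> h \<le> B \<and> (\<forall>p. hs p \<le> N)"
  by (simp add: in_space_def cfg_def)

lemma step_cfg:
  assumes "q \<noteq> Fetch []" "transition q (\<lambda>p. I p (hs p)) (T h) = (q', x, m, ms, e)"
  shows "step (machine c) I (cfg q T h hs out) =
    cfg q' (T(h := x)) (move m h) (\<lambda>p. move (ms p) (hs p)) (out @ (case e of None \<Rightarrow> [] | Some b \<Rightarrow> [b]))"
  using assms by (simp add: step_def cfg_def machine_def)

lemma path_one:
  assumes "q \<noteq> Fetch []" "transition q (\<lambda>p. I p (hs p)) (T h) = (q', x, m, ms, e)"
    and "h \<le> B" "\<forall>p. hs p \<le> N"
    and "path (machine c) I (in_space B N)
      (cfg q' (T(h := x)) (move m h) (\<lambda>p. move (ms p) (hs p)) (out @ (case e of None \<Rightarrow> [] | Some b \<Rightarrow> [b]))) D"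
  shows "path (machine c) I (in_space B N) (cfg q T h hs out) D"
  by (rule path_step) (use assms in \<open>simp_all add: step_cfg\<close>)

lemma path_rewind:
  assumes "\<forall>i. fst (T i) \<longleftrightarrow> i = 0" "\<forall>p. hs p \<le> N" "h \<le> B"
  shows "path (machine c) I (in_space B N) (cfg (Rewind k) T h hs out) (cfg (Fetch k) T 0 hs out)"
  using assms(3)
proof (induction h)
  case 0
  have "fst (T 0)" using assms(1) by simp
  then have t: "transition (Rewind k) r (T 0) = act (Fetch k) (T 0) Stay" for r
    by (cases "T 0") auto
  show ?case
    by (rule path_one, simp, rule t) (use assms in \<open>auto intro: path_refl\<close>)
next
  case (Suc h)
  have "\<not> fst (T (Suc h))" using assms(1) by simp
  then have t: "transition (Rewind k) r (T (Suc h)) = act (Rewind k) (T (Suc h)) GoLeft" for r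
    by (cases "T (Suc h)") auto
  show ?case
    by (rule path_one, simp, rule t) (use assms Suc in auto)
qed

definition same_except :: "'v \<Rightarrow> (nat \<Rightarrow> 'v cell) \<Rightarrow> (nat \<Rightarrow> 'v cell) \<Rightarrow> nat \<Rightarrow> bool" where
  "same_except v T T' p \<longleftrightarrow> (\<forall>i. fst (T' i) = fst (T i) \<and> (\<forall>u. u \<noteq> v \<or> i < p \<longrightarrow> snd (T' i) u = snd (T i) u))"

lemma same_except_update:
  "same_except v (T(p := (fst (T p), (snd (T p))(v := y)))) T' (Suc p) \<Longrightarrow> same_except v T T' p"
  unfolding same_except_def by (auto split: if_splits)

lemma path_inc:
  assumes "track T v p w" "p + length w \<le> B" "\<forall>p. hs p \<le> N"
  shows "\<exists>T' h. path (machine c) I (in_space B N) (cfg (Fetch (Inc v # k)) T p hs out) (cfg (Rewind k) T' h hs out) \<and>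
    h \<le> B \<and> track T' v p (inc w) \<and> same_except v T T' p"
  using assms(1,2)
proof (induction w arbitrary: p T rule: inc.induct)
  case 1
  let ?T = "T(p := (fst (T p), (snd (T p))(v := Some True)))"
  have t: "transition (Fetch (Inc v # k)) r (T p) = act (Rewind k) (fst (T p), (snd (T p))(v := Some True)) Stay" for r
    using 1 by (cases "T p") auto
  have "path (machine c) I (in_space B N) (cfg (Fetch (Inc v # k)) T p hs out) (cfg (Rewind k) ?T p hs out)"
    by (rule path_one, simp, rule t) (use 1 assms in \<open>auto intro: path_refl\<close>)
  moreover have "track ?T v p (inc [])" "same_except v T ?T p" "p \<le> B"
    using 1 by (auto simp: same_except_def)
  ultimately show ?case by blast
next
  case (2 w)
  let ?T = "T(p := (fst (T p), (snd (T p))(v := Some True)))"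
  have t: "transition (Fetch (Inc v # k)) r (T p) = act (Rewind k) (fst (T p), (snd (T p))(v := Some True)) Stay" for r
    using 2 by (cases "T p") auto
  have "path (machine c) I (in_space B N) (cfg (Fetch (Inc v # k)) T p hs out) (cfg (Rewind k) ?T p hs out)"
    by (rule path_one, simp, rule t) (use 2 assms in \<open>auto intro: path_refl\<close>)
  moreover have "track ?T v (Suc p) w"
    using 2 by (subst track_cong[of _ _ _ T]) auto
  then have "track ?T v p (inc (False # w))" "same_except v T ?T p" "p \<le> B"
    using 2 by (auto simp: same_except_def)
  ultimately show ?case by blast
next
  case (3 w)
  let ?T = "T(p := (fst (T p), (snd (T p))(v := Some False)))"
  have t: "transition (Fetch (Inc v # k)) r (T p) =
      act (Fetch (Inc v # k)) (fst (T p), (snd (T p))(v := Some False)) GoRight" for r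
    using 3 by (cases "T p") auto
  have tr: "track ?T v (Suc p) w"
    using 3 by (subst track_cong[of _ _ _ T]) auto
  obtain T' h where IH: "path (machine c) I (in_space B N) (cfg (Fetch (Inc v # k)) ?T (Suc p) hs out) (cfg (Rewind k) T' h hs out)"
    "h \<le> B" "track T' v (Suc p) (inc w)" "same_except v ?T T' (Suc p)"
    using 3(1)[OF tr] 3(3) by (metis add_Suc_shift length_Cons)
  have "path (machine c) I (in_space B N) (cfg (Fetch (Inc v # k)) T p hs out) (cfg (Rewind k) T' h hs out)"
    by (rule path_one, simp, rule t) (use 3 assms IH in auto)
  moreover have "snd (T' p) v = Some False" using IH(4) by (auto simp: same_except_def)
  ultimately show ?case
    using IH same_except_update by fastforce
qed

lemma path_dec:
  assumes "track T v p w" "p + length w \<le> B" "\<forall>p. hs p \<le> N" "0 < val w"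
  shows "\<exists>T' h. path (machine c) I (in_space B N) (cfg (Fetch (Dec v # k)) T p hs out) (cfg (Rewind k) T' h hs out) \<and>
    h \<le> B \<and> track T' v p (dec w) \<and> same_except v T T' p"
  using assms(1,2,4)
proof (induction w arbitrary: p T rule: dec.induct)
  case 1
  then show ?case by simp
next
  case (2 w)
  let ?T = "T(p := (fst (T p), (snd (T p))(v := Some False)))"
  have t: "transition (Fetch (Dec v # k)) r (T p) = act (Rewind k) (fst (T p), (snd (T p))(v := Some False)) Stay" for r
    using 2 by (cases "T p") auto
  have "path (machine c) I (in_space B N) (cfg (Fetch (Dec v # k)) T p hs out) (cfg (Rewind k) ?T p hs out)"
    by (rule path_one, simp, rule t) (use 2 assms in \<open>auto intro: path_refl\<close>)
  moreover have "track ?T v (Suc p) w"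
    using 2 by (subst track_cong[of _ _ _ T]) auto
  then have "track ?T v p (dec (True # w))" "same_except v T ?T p" "p \<le> B"
    using 2 by (auto simp: same_except_def)
  ultimately show ?case by blast
next
  case (3 w)
  let ?T = "T(p := (fst (T p), (snd (T p))(v := Some True)))"
  have t: "transition (Fetch (Dec v # k)) r (T p) =
      act (Fetch (Dec v # k)) (fst (T p), (snd (T p))(v := Some True)) GoRight" for r
    using 3 by (cases "T p") auto
  have tr: "track ?T v (Suc p) w"
    using 3 by (subst track_cong[of _ _ _ T]) auto
  obtain T' h where IH: "path (machine c) I (in_space B N) (cfg (Fetch (Dec v # k)) ?T (Suc p) hs out) (cfg (Rewind k) T' h hs out)"
    "h \<le> B" "track T' v (Suc p) (dec w)" "same_except v ?T T' (Suc p)"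
    using 3(1)[OF tr] 3(3,4) by (metis add_Suc_shift length_Cons mult_2 add_0 nat_0_less_mult_iff of_bool_eq(1) val.simps(2))
  have "path (machine c) I (in_space B N) (cfg (Fetch (Dec v # k)) T p hs out) (cfg (Rewind k) T' h hs out)"
    by (rule path_one, simp, rule t) (use 3 assms IH in auto)
  moreover have "snd (T' p) v = Some True" using IH(4) by (auto simp: same_except_def)
  ultimately show ?case
    using IH same_except_update by fastforce
qed

lemma represents_update:
  assumes "represents B s T" "same_except v T T' 0" "track T' v 0 w" "length w \<le> B"
  shows "represents B (s(v := val w)) T'"
  unfolding represents_def
proof (intro conjI allI)
  fix i show "fst (T' i) \<longleftrightarrow> i = 0"
    using assms by (auto simp: represents_def same_except_def)
next
  fix u
  show "\<exists>w'. length w' \<le> B \<and> track T' u 0 w' \<and> val w' = (s(v := val w)) u"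
  proof (cases "u = v")
    case False
    obtain w' where "length w' \<le> B" "track T u 0 w'" "val w' = s u"
      using assms(1) by (auto simp: represents_def)
    moreover have "track T' u 0 w' = track T u 0 w'"
      using assms(2) False by (intro track_cong) (auto simp: same_except_def)
    ultimately show ?thesis using False by auto
  qed (use assms in auto)
qed

text \<open>Serves \<open>IfElse\<close> and \<open>While\<close> together; \<open>g\<close> maps
  the outcome of the test to the stack that follows.\<close>

lemma path_cond:
  assumes R: "represents B s T" and "\<forall>p. hs p \<le> N"
    and q: "\<And>r m a. transition (Fetch q) r (m, a) = (case probe b r a of
        None \<Rightarrow> act (Fetch q) (m, a) GoRight | Some t \<Rightarrow> act (Rewind (g t)) (m, a) Stay)" "q \<noteq> []"
  shows "path (machine c) I (in_space B N) (cfg (Fetch q) T 0 hs out) (cfg (Fetch (g (holds I b (s, hs, out)))) T 0 hs out)"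
proof (cases b)
  case (Pos v)
  obtain w where w: "length w \<le> B" "track T v 0 w" "val w = s v"
    using R by (auto simp: represents_def)
  have "\<exists>h\<le>B. path (machine c) I (in_space B N) (cfg (Fetch q) T p hs out)
      (cfg (Rewind (g (0 < val w))) T h hs out)"
    if "track T v p w" "p + length w \<le> B" for w p
    using that
  proof (induction w arbitrary: p)
    case Nil
    then have t: "transition (Fetch q) r (T p) = act (Rewind (g False)) (T p) Stay" for r
      by (cases "T p") (auto simp: q Pos)
    have "path (machine c) I (in_space B N) (cfg (Fetch q) T p hs out) (cfg (Rewind (g False)) T p hs out)"
      by (rule path_one, simp add: q, rule t) (use Nil assms in \<open>auto intro: path_refl\<close>)
    then show ?case using Nil by auto
  next
    case (Cons a w)
    show ?case
    proof (cases a)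
      case True
      have t: "transition (Fetch q) r (T p) = act (Rewind (g True)) (T p) Stay" for r
        using Cons True by (cases "T p") (auto simp: q Pos)
      have "path (machine c) I (in_space B N) (cfg (Fetch q) T p hs out) (cfg (Rewind (g True)) T p hs out)"
        by (rule path_one, simp add: q, rule t) (use Cons assms in \<open>auto intro: path_refl\<close>)
      then show ?thesis using Cons True by (intro exI[of _ p]) auto
    next
      case False
      have t: "transition (Fetch q) r (T p) = act (Fetch q) (T p) GoRight" for r
        using Cons False by (cases "T p") (auto simp: q Pos)
      obtain h where h: "h \<le> B" "path (machine c) I (in_space B N) (cfg (Fetch q) T (Suc p) hs out)
          (cfg (Rewind (g (0 < val w))) T h hs out)"
        using Cons.IH[of "Suc p"] Cons.prems by auto
      have "path (machine c) I (in_space B N) (cfg (Fetch q) T p hs out)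
          (cfg (Rewind (g (0 < val w))) T h hs out)"
        by (rule path_one, simp add: q, rule t) (use Cons assms h in auto)
      then show ?thesis using h False by auto
    qed
  qed
  from this[OF w(2)] w obtain h where "h \<le> B" "path (machine c) I (in_space B N) (cfg (Fetch q) T 0 hs out)
      (cfg (Rewind (g (0 < val w))) T h hs out)" by auto
  moreover from this have "path (machine c) I (in_space B N) (cfg (Rewind (g (0 < val w))) T h hs out)
      (cfg (Fetch (g (0 < val w))) T 0 hs out)"
    using R assms by (intro path_rewind) (auto simp: represents_def)
  ultimately show ?thesis using Pos w by (auto intro: path_trans)
next
  case (Sees p S)
  have t: "transition (Fetch q) (\<lambda>p. I p (hs p)) (T 0) = act (Rewind (g (I p (hs p) \<in> S))) (T 0) Stay"
    by (cases "T 0") (auto simp: q Sees)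
  show ?thesis
    by (rule path_one, simp add: q, rule t)
      (use R assms Sees in \<open>auto simp: represents_def intro!: path_rewind\<close>)
qed

text \<open>Each command starts and ends with the work head on cell 0 and leaves the stack
  \<open>k\<close> below it untouched, so simulations compose. The program \<open>c\<^sub>0\<close>
  of the machine is arbitrary because all these machines share their transition function and final
  state.\<close>

lemma big_simulated:
  assumes "big N I c x y" "x = (s, hs, out)" "y = (s', hs', out')"
    and "N < 2 ^ B" "represents B s T" "\<forall>p. hs p \<le> N"
  shows "(\<forall>p. hs' p \<le> N) \<and> (\<exists>T'. represents B s' T' \<and>
    path (machine c\<^sub>0) I (in_space B N) (cfg (Fetch (c # k)) T 0 hs out) (cfg (Fetch k) T' 0 hs' out'))"
  using assms
proof (induction arbitrary: s hs out s' hs' out' T k rule: big.induct)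
  case (Skip x)
  have t: "transition (Fetch (Skip # k)) r (T 0) = act (Fetch k) (T 0) Stay" for r
    by (cases "T 0") auto
  have "path (machine c\<^sub>0) I (in_space B N) (cfg (Fetch (Skip # k)) T 0 hs out) (cfg (Fetch k) T 0 hs out)"
    by (rule path_one, simp, rule t) (use Skip in \<open>auto intro: path_refl\<close>)
  then show ?case using Skip by auto
next
  case (Inc s0 v hs0 out0)
  then have [simp]: "s0 = s" "hs0 = hs" "out0 = out" "hs' = hs" "out' = out" and s': "s' = s(v := Suc (s v))" by auto
  obtain w where w: "length w \<le> B" "track T v 0 w" "val w = s v"
    using Inc.prems(4) unfolding represents_def by blast
  obtain T' h where T': "path (machine c\<^sub>0) I (in_space B N) (cfg (Fetch (Inc v # k)) T 0 hs out) (cfg (Rewind k) T' h hs out)"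
    "h \<le> B" "track T' v 0 (inc w)" "same_except v T T' 0"
    using path_inc[OF w(2), where B=B and hs=hs and N=N and c=c\<^sub>0 and I=I and k=k and out=out] w Inc.prems by auto
  \<comment> \<open>An overflow at full length would produce the value \<open>2 ^ B\<close>, which
    exceeds \<open>N\<close>.\<close>
  have "length (inc w) \<le> B"
  proof (rule ccontr)
    assume "\<not> ?thesis"
    then have "2 ^ length w \<le> val (inc w)" "length w = B" using length_inc[of w] w by auto
    then show False using Inc w by (simp add: val_inc)
  qed
  then have "represents B s' T'"
    using represents_update[OF Inc.prems(4) T'(4,3)] s' w by (simp add: val_inc)
  moreover from this have "path (machine c\<^sub>0) I (in_space B N) (cfg (Rewind k) T' h hs out) (cfg (Fetch k) T' 0 hs out)"
    using Inc.prems T' by (intro path_rewind) (auto simp: represents_def)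
  ultimately show ?case using T' Inc.prems by (auto intro: path_trans)
next
  case (Dec s0 v hs0 out0)
  then have [simp]: "s0 = s" "hs0 = hs" "out0 = out" "hs' = hs" "out' = out" and s': "s' = s(v := s v - 1)" by auto
  obtain w where w: "length w \<le> B" "track T v 0 w" "val w = s v"
    using Dec.prems(4) unfolding represents_def by blast
  obtain T' h where T': "path (machine c\<^sub>0) I (in_space B N) (cfg (Fetch (Dec v # k)) T 0 hs out) (cfg (Rewind k) T' h hs out)"
    "h \<le> B" "track T' v 0 (dec w)" "same_except v T T' 0"
    using path_dec[OF w(2), where B=B and hs=hs and N=N and c=c\<^sub>0 and I=I and k=k and out=out] w Dec by auto
  have "represents B s' T'"
    using represents_update[OF Dec.prems(4) T'(4,3)] s' w Dec by (simp add: val_dec)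
  moreover from this have "path (machine c\<^sub>0) I (in_space B N) (cfg (Rewind k) T' h hs out) (cfg (Fetch k) T' 0 hs out)"
    using Dec.prems T' by (intro path_rewind) (auto simp: represents_def)
  ultimately show ?case using T' Dec.prems by (auto intro: path_trans)
next
  case (Emit b s0 hs0 out0)
  have t: "transition (Fetch (Emit b # k)) r (T 0) = (Fetch k, T 0, Stay, \<lambda>_. Stay, Some b)" for r
    by (cases "T 0") auto
  have "path (machine c\<^sub>0) I (in_space B N) (cfg (Fetch (Emit b # k)) T 0 hs out) (cfg (Fetch k) T 0 hs (out @ [b]))"
    by (rule path_one, simp, rule t) (use Emit in \<open>auto intro: path_refl\<close>)
  then show ?case using Emit by auto
next
  case (Shift m hs0 p s0 out0)
  have t: "transition (Fetch (Shift p m # k)) r (T 0) = (Fetch k, T 0, Stay, (\<lambda>_. Stay)(p := m), None)" for r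
    by (cases "T 0") auto
  have e: "(\<lambda>p'. move (if p' = p then m else Stay) (hs p')) = hs(p := move m (hs p))" by auto
  have "path (machine c\<^sub>0) I (in_space B N) (cfg (Fetch (Shift p m # k)) T 0 hs out)
      (cfg (Fetch k) T 0 (hs(p := move m (hs p))) out)"
    by (rule path_one, simp, rule t) (use Shift in \<open>auto intro: path_refl simp: e\<close>)
  then show ?case using Shift by auto
next
  case (Seq c1 x y c2 z)
  obtain s1 hs1 out1 where y: "y = (s1, hs1, out1)" by (cases y)
  have t: "transition (Fetch ((c1 ;; c2) # k)) r (T 0) = act (Fetch (c1 # c2 # k)) (T 0) Stay" for r
    by (cases "T 0") auto
  from Seq.IH(1)[OF Seq.prems(1) y Seq.prems(3-5), of "c2 # k"] obtain T1 where T1: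
    "represents B s1 T1" "\<forall>p. hs1 p \<le> N"
    "path (machine c\<^sub>0) I (in_space B N) (cfg (Fetch (c1 # c2 # k)) T 0 hs out) (cfg (Fetch (c2 # k)) T1 0 hs1 out1)"
    by auto
  from Seq.IH(2)[OF y Seq.prems(2,3) T1(1,2), of k] obtain T2 where T2:
    "represents B s' T2" "\<forall>p. hs' p \<le> N"
    "path (machine c\<^sub>0) I (in_space B N) (cfg (Fetch (c2 # k)) T1 0 hs1 out1) (cfg (Fetch k) T2 0 hs' out')"
    by auto
  have "path (machine c\<^sub>0) I (in_space B N) (cfg (Fetch ((c1 ;; c2) # k)) T 0 hs out) (cfg (Fetch k) T2 0 hs' out')"
    by (rule path_one, simp, rule t) (use Seq path_trans[OF T1(3) T2(3)] in auto)
  then show ?case using T2 by auto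
next
  case (IfTrue b x c1 y c2)
  have "path (machine c\<^sub>0) I (in_space B N) (cfg (Fetch (IfElse b c1 c2 # k)) T 0 hs out) (cfg (Fetch (c1 # k)) T 0 hs out)"
    using path_cond[where B=B and s=s and T=T and hs=hs and N=N and q="IfElse b c1 c2 # k" and b=b and g="\<lambda>t. (if t then c1 else c2) # k" and c=c\<^sub>0 and I=I and out=out] IfTrue by simp
  moreover from IfTrue.IH[OF IfTrue.prems, of k] obtain T' where "represents B s' T'" "\<forall>p. hs' p \<le> N"
    "path (machine c\<^sub>0) I (in_space B N) (cfg (Fetch (c1 # k)) T 0 hs out) (cfg (Fetch k) T' 0 hs' out')" by auto
  ultimately show ?case by (auto intro: path_trans)
next
  case (IfFalse b x c2 y c1)
  have "path (machine c\<^sub>0) I (in_space B N) (cfg (Fetch (IfElse b c1 c2 # k)) T 0 hs out) (cfg (Fetch (c2 # k)) T 0 hs out)"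
    using path_cond[where B=B and s=s and T=T and hs=hs and N=N and q="IfElse b c1 c2 # k" and b=b and g="\<lambda>t. (if t then c1 else c2) # k" and c=c\<^sub>0 and I=I and out=out] IfFalse by simp
  moreover from IfFalse.IH[OF IfFalse.prems, of k] obtain T' where "represents B s' T'" "\<forall>p. hs' p \<le> N"
    "path (machine c\<^sub>0) I (in_space B N) (cfg (Fetch (c2 # k)) T 0 hs out) (cfg (Fetch k) T' 0 hs' out')" by auto
  ultimately show ?case by (auto intro: path_trans)
next
  case (WhileTrue b x c y z)
  obtain s1 hs1 out1 where y: "y = (s1, hs1, out1)" by (cases y)
  have 1: "path (machine c\<^sub>0) I (in_space B N) (cfg (Fetch (While b c # k)) T 0 hs out) (cfg (Fetch (c # While b c # k)) T 0 hs out)"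
    using path_cond[where B=B and s=s and T=T and hs=hs and N=N and q="While b c # k" and b=b and g="\<lambda>t. if t then c # While b c # k else k" and c=c\<^sub>0 and I=I and out=out] WhileTrue by simp
  from WhileTrue.IH(1)[OF WhileTrue.prems(1) y WhileTrue.prems(3-5), of "While b c # k"] obtain T1 where T1:
    "represents B s1 T1" "\<forall>p. hs1 p \<le> N"
    "path (machine c\<^sub>0) I (in_space B N) (cfg (Fetch (c # While b c # k)) T 0 hs out) (cfg (Fetch (While b c # k)) T1 0 hs1 out1)"
    by auto
  from WhileTrue.IH(2)[OF y WhileTrue.prems(2,3) T1(1,2), of k] obtain T2 where T2:
    "represents B s' T2" "\<forall>p. hs' p \<le> N"
    "path (machine c\<^sub>0) I (in_space B N) (cfg (Fetch (While b c # k)) T1 0 hs1 out1) (cfg (Fetch k) T2 0 hs' out')"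
    by auto
  show ?case using path_trans[OF 1 path_trans[OF T1(3) T2(3)]] T2 by auto
next
  case (WhileFalse b x c)
  have "path (machine c\<^sub>0) I (in_space B N) (cfg (Fetch (While b c # k)) T 0 hs out) (cfg (Fetch k) T 0 hs out)"
    using path_cond[where B=B and s=s and T=T and hs=hs and N=N and q="While b c # k" and b=b and g="\<lambda>t. if t then c # While b c # k else k" and c=c\<^sub>0 and I=I and out=out] WhileFalse by simp
  then show ?case using WhileFalse by auto
qed

text \<open>The same \<open>B\<close> pays for both charges: words of length at most
  \<open>B\<close> keep the work head at or left of cell \<open>B\<close>, and input positions up to
  \<open>N < 2 ^ B\<close> have addresses of at most \<open>B\<close> bits.\<close>

lemma machine_outputs:
  assumes "big N I c (\<lambda>_. 0, \<lambda>_. 0, []) (s, hs, out)" "N < 2 ^ B"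
  shows "outputs_in_space (machine c) I out (real (Suc B))"
proof -
  let ?T = "(\<lambda>_. (False, \<lambda>_. None))(0 := (True, \<lambda>_. None))"
  have "represents B (\<lambda>_. 0) ?T"
    unfolding represents_def by (auto intro!: exI[of _ "[]"])
  from big_simulated[OF assms(1) refl refl assms(2) this, of c "[]"] obtain T' where
    T': "path (machine c) I (in_space B N) (cfg (Fetch [c]) ?T 0 (\<lambda>_. 0) []) (cfg (Fetch []) T' 0 hs out)"
    by auto
  have "path (machine c) I (in_space B N) (cfg (Boot c) (\<lambda>_. (False, \<lambda>_. None)) 0 (\<lambda>_. 0) []) (cfg (Fetch []) T' 0 hs out)"
    by (rule path_one[where q' = "Fetch [c]" and x = "(True, \<lambda>_. None)" and m = Stay and ms = "\<lambda>_. Stay" and e = None])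
      (use T' in auto)
  moreover have "initial_config (machine c) = cfg (Boot c) (\<lambda>_. (False, \<lambda>_. None)) 0 (\<lambda>_. 0) []"
    by (simp add: initial_config_def cfg_def machine_def)
  ultimately have P: "path (machine c) I (in_space B N) (initial_config (machine c)) (cfg (Fetch []) T' 0 hs out)"
    by simp
  have fin: "state (cfg (Fetch []) T' 0 hs out) = final (machine c)"
    by (simp add: cfg_def machine_def)
  from path_final[OF P fin] obtain t where t: "run (machine c) I t = cfg (Fetch []) T' 0 hs out"
    and all: "in_space B N (run (machine c) I u)" for u
    by (auto simp: run_def)
  have "log 2 (1 + real (input_head (run (machine c) I u) p)) \<le> real (Suc B)" for u p
  proof -
    have "input_head (run (machine c) I u) p < 2 ^ B"
      using all[of u] assms(2) by (auto simp: in_space_def intro: le_less_trans)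
    then have "1 + real (input_head (run (machine c) I u) p) \<le> 2 ^ B"
      by (metis Suc_leI of_nat_Suc of_nat_le_iff of_nat_numeral of_nat_power add.commute)
    then have "log 2 (1 + real (input_head (run (machine c) I u) p)) \<le> log 2 (2 ^ B)"
      by (subst log_le_cancel_iff) auto
    then show ?thesis by simp
  qed
  moreover have "real (Suc (work_head (run (machine c) I u))) \<le> real (Suc B)" for u
    using all[of u] by (auto simp: in_space_def)
  ultimately show ?thesis
    unfolding outputs_in_space_def using t fin
    by (intro conjI exI[of _ t]) (auto simp: cfg_def)
qed

section \<open>Transport to machines over the natural numbers\<close>

definition rename :: "('q \<Rightarrow> 'r) \<Rightarrow> ('a \<Rightarrow> 'b) \<Rightarrow> ('q, 'a) tm \<Rightarrow> ('r, 'b) tm" where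
  "rename f g M = \<lparr>states = f ` states M, alphabet = g ` alphabet M, start = f (start M),
     final = f (final M), blank = g (blank M),
     delta = (\<lambda>q r a. case delta M (inv_into (states M) f q) r (inv_into (alphabet M) g a) of
       (q', a', rest) \<Rightarrow> (f q', g a', rest))\<rparr>"

text \<open>Well-formedness keeps the run inside the sets on which \<open>f\<close> and
  \<open>g\<close> are injective, so decoding by \<open>inv_into\<close> is exact at every
  step.\<close>

lemma rename_run:
  assumes wf: "wf_tm M" and f: "inj_on f (states M)" and g: "inj_on g (alphabet M)"
  shows "run (rename f g M) I t = \<lparr>state = f (state (run M I t)), work = g \<circ> work (run M I t),
     work_head = work_head (run M I t), input_head = input_head (run M I t), emitted = emitted (run M I t)\<rparr>
   \<and> state (run M I t) \<in> states M \<and> (\<forall>i. work (run M I t) i \<in> alphabet M)"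
proof (induction t)
  case 0
  show ?case
    using wf by (auto simp: run_def initial_config_def rename_def wf_tm_def fun_eq_iff)
next
  case (Suc t)
  let ?C = "run M I t"
  have S: "run M I (Suc t) = step M I ?C" "run (rename f g M) I (Suc t) = step (rename f g M) I (run (rename f g M) I t)"
    by (simp_all add: run_def)
  have q: "state ?C \<in> states M" and a: "work ?C i \<in> alphabet M" for i
    using Suc by auto
  obtain q' a' m ms e where d: "delta M (state ?C) (\<lambda>p. I p (input_head ?C p)) (work ?C (work_head ?C)) = (q', a', m, ms, e)"
    by (metis prod_cases5)
  have cl: "q' \<in> states M" "a' \<in> alphabet M"
    using wf q a d unfolding wf_tm_def by (metis fst_conv, metis fst_conv snd_conv)
  have fin: "f (state ?C) = f (final M) \<longleftrightarrow> state ?C = final M"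
    using f q wf by (auto simp: wf_tm_def inj_on_eq_iff)
  show ?case
    unfolding S using Suc cl d a q
    by (auto simp: step_def rename_def fin f g inv_into_f_f fun_eq_iff)
qed

lemma rename_outputs:
  assumes "wf_tm M" "inj_on f (states M)" "inj_on g (alphabet M)" "outputs_in_space M I bs s"
  shows "outputs_in_space (rename f g M) I bs s"
proof -
  have "f (state (run M I t)) = f (final M) \<longleftrightarrow> state (run M I t) = final M" for t
    using rename_run[OF assms(1-3), of I t] assms by (auto simp: wf_tm_def inj_on_eq_iff)
  moreover have "final (rename f g M) = f (final M)" by (simp add: rename_def)
  ultimately show ?thesis
    using assms(4) by (simp add: outputs_in_space_def rename_run[OF assms(1-3)])
qed

lemma wf_rename:
  assumes "wf_tm M" "inj_on f (states M)" "inj_on g (alphabet M)"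
  shows "wf_tm (rename f g M)"
  using assms unfolding wf_tm_def rename_def
  by (auto simp: inv_into_f_f split: prod.splits) (metis fst_conv snd_conv image_eqI)+

lemma nat_tm:
  fixes M :: "('q, 'a) tm"
  assumes "wf_tm M"
  shows "\<exists>M' :: (nat, nat) tm. wf_tm M' \<and>
    (\<forall>I bs s. outputs_in_space M I bs s \<longrightarrow> outputs_in_space M' I bs s)"
proof -
  have "finite (states M)" "finite (alphabet M)" using assms by (auto simp: wf_tm_def)
  then obtain f :: "'q \<Rightarrow> nat" and g :: "'a \<Rightarrow> nat" where "inj_on f (states M)" "inj_on g (alphabet M)"
    by (meson finite_imp_inj_to_nat_seg)
  then show ?thesis
    using assms wf_rename rename_outputs by (intro exI[of _ "rename f g M"]) blast
qed

section \<open>Walks of intervals under the tent map\<close>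

text \<open>The value for the empty word is chosen so that the first bit obeys the same rule as all
  others: keep the last bit left of 1/2, flip it right of 1/2.\<close>

definition lastbit :: "bool list \<Rightarrow> bool" where
  "lastbit w \<longleftrightarrow> w \<noteq> [] \<and> last w"

definition image_of :: "real \<Rightarrow> real set \<Rightarrow> bool list \<Rightarrow> real set" where
  "image_of \<mu> J w = {(tent \<mu> ^^ length w) x | x. x \<in> J \<and> tent_code \<mu> (length w) x = w}"

lemma image_of_extend:
  assumes "V \<subseteq> image_of \<mu> J w" "\<And>y. y \<in> V \<Longrightarrow> if s then y > 1/2 else y < 1/2"
  shows "tent \<mu> ` V \<subseteq> image_of \<mu> J (w @ [lastbit w \<noteq> s])"
proof
  fix y assume "y \<in> tent \<mu> ` V"
  then obtain v where v: "v \<in> V" "y = tent \<mu> v" by blast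
  then obtain x where x: "x \<in> J" "tent_code \<mu> (length w) x = w" "v = (tent \<mu> ^^ length w) x"
    using assms(1) by (auto simp: image_of_def)
  have side: "if s then v > 1/2 else v < 1/2" using assms(2) v by blast
  have "tent_bit \<mu> x (length w) \<longleftrightarrow> lastbit w \<noteq> s"
  proof (cases "length w")
    case 0
    then show ?thesis using side x by (auto simp: lastbit_def split: if_splits)
  next
    case (Suc m)
    have "last w = tent_bit \<mu> x m"
      using x(2) Suc by (metis Suc_neq_Zero diff_Suc_1 last_conv_nth lessI length_0_conv nth_map nth_upt tent_code_def add_0 length_upt minus_nat.diff_0)
    then show ?thesis using side x Suc by (auto simp: lastbit_def Let_def split: if_splits)
  qed
  then show "y \<in> image_of \<mu> J (w @ [lastbit w \<noteq> s])"
    using x v by (auto simp: image_of_def tent_code_def intro!: exI[of _ x])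
qed

lemma image_of_nonempty:
  assumes "y \<in> image_of \<mu> J w"
  shows "\<exists>x\<in>J. tent_code \<mu> (length w) x = w"
  using assms by (auto simp: image_of_def)

text \<open>Open, so that a segment ending at 1/2 misses the critical point, where the code follows
  its exceptional rule. The ends are unordered because the right branch of the map reverses
  orientation.\<close>

definition segment :: "real \<Rightarrow> real \<Rightarrow> real set" where
  "segment a z = {min a z<..<max a z}"

definition straddles :: "real \<Rightarrow> real \<Rightarrow> bool" where
  "straddles a z \<longleftrightarrow> a < 1/2 \<and> 1/2 < z \<or> z < 1/2 \<and> 1/2 < a"

lemma tent_left: "x \<le> 1/2 \<Longrightarrow> tent \<mu> x = \<mu> * x"
  and tent_right: "x \<ge> 1/2 \<Longrightarrow> tent \<mu> x = \<mu> * (1 - x)"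
  by (auto simp: tent_def)

lemma tent_reflect: "\<bar>x - 1/2\<bar> = \<bar>y - 1/2\<bar> \<Longrightarrow> tent \<mu> x = tent \<mu> y"
proof -
  assume "\<bar>x - 1/2\<bar> = \<bar>y - 1/2\<bar>"
  then have "x = y \<or> x = 1 - y" by linarith
  then show ?thesis by (auto simp: tent_def)
qed

lemma not_straddles_cases:
  assumes "\<not> straddles a z"
  obtains "a \<le> 1/2" "z \<le> 1/2" | "a \<ge> 1/2" "z \<ge> 1/2"
  using assms unfolding straddles_def by linarith

lemma tent_dist:
  assumes "\<not> straddles a z" "0 < \<mu>"
  shows "\<bar>tent \<mu> a - tent \<mu> z\<bar> = \<mu> * \<bar>a - z\<bar>"
proof -
  have "tent \<mu> a - tent \<mu> z = \<mu> * (a - z) \<or> tent \<mu> a - tent \<mu> z = \<mu> * (z - a)"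
    using assms by (auto simp: straddles_def tent_def algebra_simps)
  then show ?thesis
    using assms(2) by (auto simp: abs_mult abs_minus_commute)
qed

lemma segment_tent:
  assumes "\<not> straddles a z" "0 < \<mu>"
  shows "segment (tent \<mu> a) (tent \<mu> z) \<subseteq> tent \<mu> ` segment a z"
proof
  fix y assume y: "y \<in> segment (tent \<mu> a) (tent \<mu> z)"
  from assms(1) show "y \<in> tent \<mu> ` segment a z"
  proof (cases rule: not_straddles_cases)
    case 1
    have "y / \<mu> \<in> segment a z"
      using y assms(2) by (auto simp: segment_def tent_left[OF 1(1)] tent_left[OF 1(2)] min_def max_def field_simps split: if_splits)
    moreover from this have "y / \<mu> \<le> 1/2" using 1 unfolding segment_def greaterThanLessThan_iff by linarith
    then have "tent \<mu> (y / \<mu>) = y" using assms(2) by (subst tent_left) simp_all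
    ultimately show ?thesis by (metis imageI)
  next
    case 2
    have "1 - y / \<mu> \<in> segment a z"
      using y assms(2) by (auto simp: segment_def tent_right[OF 2(1)] tent_right[OF 2(2)] min_def max_def field_simps split: if_splits)
    moreover from this have "1 - y / \<mu> \<ge> 1/2" using 2 unfolding segment_def greaterThanLessThan_iff by linarith
    then have "tent \<mu> (1 - y / \<mu>) = y" using assms(2) by (subst tent_right) simp_all
    ultimately show ?thesis by (metis imageI)
  qed
qed

section \<open>Segments that end at the critical point\<close>

definition unbroken :: "real \<Rightarrow> real \<Rightarrow> nat \<Rightarrow> bool" where
  "unbroken \<mu> \<delta> i \<longleftrightarrow>
     (\<forall>j. 1 \<le> j \<and> j < i \<longrightarrow> \<not> straddles ((tent \<mu> ^^ j) (1/2)) ((tent \<mu> ^^ j) (1/2 - \<delta>)))"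

text \<open>While no image straddles 1/2, a single branch of the map acts on the whole segment at
  each step, so the iterate is affine with slope of modulus \<open>\<mu> ^ i\<close>;
  \<open>s\<close> records the orientation.\<close>

lemma unbroken_affine:
  assumes "unbroken \<mu> \<delta> i" "1 \<le> i" "0 \<le> \<delta>"
  shows "\<exists>s. \<bar>s\<bar> = 1 \<and> (\<forall>t\<in>{0..\<delta>}. (tent \<mu> ^^ i) (1/2 - t) = (tent \<mu> ^^ i) (1/2) + s * \<mu> ^ i * t)"
  using assms(2,1)
proof (induction i rule: dec_induct)
  case base
  show ?case
    by (intro exI[of _ "-1"]) (auto simp: tent_def algebra_simps)
next
  case (step i)
  then have "unbroken \<mu> \<delta> i" by (auto simp: unbroken_def)
  then obtain s where s: "\<bar>s\<bar> = 1" and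
    eq: "\<And>t. t \<in> {0..\<delta>} \<Longrightarrow> (tent \<mu> ^^ i) (1/2 - t) = (tent \<mu> ^^ i) (1/2) + s * \<mu> ^ i * t"
    using step by blast
  let ?a = "(tent \<mu> ^^ i) (1/2)"
  have ns: "\<not> straddles ?a (?a + s * \<mu> ^ i * \<delta>)"
    using step.prems step.hyps eq[of \<delta>] assms(3) unfolding unbroken_def by (metis atLeastAtMost_iff lessI order_refl)
  have btw: "min ?a (?a + s * \<mu> ^ i * \<delta>) \<le> ?a + s * \<mu> ^ i * t \<and> ?a + s * \<mu> ^ i * t \<le> max ?a (?a + s * \<mu> ^ i * \<delta>)"
    if "t \<in> {0..\<delta>}" for t
  proof -
    have "min 0 (r * \<delta>) \<le> r * t \<and> r * t \<le> max 0 (r * \<delta>)" for r :: real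
      using that by (cases "0 \<le> r") (auto simp: min_le_iff_disj le_max_iff_disj intro: mult_left_mono mult_left_mono_neg mult_nonpos_nonneg)
    from this[of "s * \<mu> ^ i"] show ?thesis by linarith
  qed
  from ns show ?case
  proof (cases rule: not_straddles_cases)
    case 1
    have "(tent \<mu> ^^ Suc i) (1/2 - t) = (tent \<mu> ^^ Suc i) (1/2) + s * \<mu> ^ Suc i * t"
      if t: "t \<in> {0..\<delta>}" for t
    proof -
      have "?a + s * \<mu> ^ i * t \<le> 1/2" using 1 btw[OF t] by linarith
      then show ?thesis using 1 eq[OF t] by (simp add: tent_left distrib_left mult.left_commute mult.assoc)
    qed
    then show ?thesis using s by blast
  next
    case 2
    have "(tent \<mu> ^^ Suc i) (1/2 - t) = (tent \<mu> ^^ Suc i) (1/2) + (- s) * \<mu> ^ Suc i * t"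
      if t: "t \<in> {0..\<delta>}" for t
    proof -
      have "?a + s * \<mu> ^ i * t \<ge> 1/2" using 2 btw[OF t] by linarith
      then show ?thesis using 2 eq[OF t] by (simp add: tent_right algebra_simps)
    qed
    then show ?thesis using s by (intro exI[of _ "-s"]) auto
  qed
qed

lemma unbroken_width:
  assumes "unbroken \<mu> \<delta> i" "1 \<le> i" "0 \<le> \<delta>" "0 < \<mu>"
  shows "\<bar>(tent \<mu> ^^ i) (1/2) - (tent \<mu> ^^ i) (1/2 - \<delta>)\<bar> = \<mu> ^ i * \<delta>"
proof -
  obtain s where "\<bar>s\<bar> = 1" "(tent \<mu> ^^ i) (1/2 - \<delta>) = (tent \<mu> ^^ i) (1/2) + s * \<mu> ^ i * \<delta>"
    using unbroken_affine[OF assms(1-3)] assms(3) by auto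
  then show ?thesis using assms by (auto simp: abs_mult)
qed

text \<open>By affinity the shorter segment maps into the image of the longer one and shares its end
  on the critical orbit. A shrunken segment therefore is not cut earlier than the one it
  replaces.\<close>

lemma unbroken_mono:
  assumes "unbroken \<mu> \<delta> i" "0 \<le> \<delta>'" "\<delta>' \<le> \<delta>"
  shows "unbroken \<mu> \<delta>' i"
  unfolding unbroken_def
proof (intro allI impI)
  fix j assume j: "1 \<le> j \<and> j < i"
  let ?a = "(tent \<mu> ^^ j) (1/2)"
  have u: "unbroken \<mu> \<delta> j" and ns: "\<not> straddles ?a ((tent \<mu> ^^ j) (1/2 - \<delta>))"
    using assms j by (auto simp: unbroken_def)
  obtain s where s: "(tent \<mu> ^^ j) (1/2 - \<delta>) = ?a + s * \<mu> ^ j * \<delta>" "(tent \<mu> ^^ j) (1/2 - \<delta>') = ?a + s * \<mu> ^ j * \<delta>'"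
    using unbroken_affine[OF u] j assms by force
  have "r * \<delta>' \<le> r * \<delta> \<and> 0 \<le> r * \<delta>' \<or> r * \<delta>' \<ge> r * \<delta> \<and> 0 \<ge> r * \<delta>'" for r :: real
    using assms by (cases "0 \<le> r") (auto intro: mult_left_mono mult_left_mono_neg mult_nonpos_nonneg)
  from this[of "s * \<mu> ^ j"]
  show "\<not> straddles ?a ((tent \<mu> ^^ j) (1/2 - \<delta>'))"
    using ns unfolding s straddles_def by linarith
qed

text \<open>Each factor is at least \<open>j * ln \<mu>\<close>, which gives the factorial. Its
  inverse \<open>(1 / ln \<mu>) ^ r / fact r\<close> is a single term of the exponential series at
  \<open>1 / ln \<mu>\<close>, hence at most the sum of the series, uniformly in
  \<open>r\<close>.\<close>

lemma prod_power_minus_one_ge: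
  fixes \<mu> :: real
  assumes "1 < \<mu>"
  shows "exp (- (1 / ln \<mu>)) \<le> (\<Prod>j=1..r. \<mu> ^ j - 1)"
proof -
  let ?l = "ln \<mu>"
  have l: "0 < ?l" using assms by simp
  have "(1 / ?l) ^ r / fact r \<le> exp (1 / ?l)"
  proof -
    have "(1 / ?l) ^ r / fact r = (\<Sum>n\<in>{r}. inverse (fact n) * (1 / ?l) ^ n)"
      by (simp add: field_simps)
    also have "\<dots> \<le> (\<Sum>n. inverse (fact n) * (1 / ?l) ^ n)"
      using l by (intro sum_le_suminf summable_exp) auto
    also have "\<dots> = exp (1 / ?l)"
      by (simp add: exp_def)
    finally show ?thesis .
  qed
  then have "exp (- (1 / ?l)) \<le> fact r * ?l ^ r"
    using l by (simp add: exp_minus field_simps)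
  also have "\<dots> = (\<Prod>j=1..r. real j * ?l)"
    by (simp add: prod.distrib fact_prod)
  also have "\<dots> \<le> (\<Prod>j=1..r. \<mu> ^ j - 1)"
  proof (intro prod_mono conjI)
    fix j
    have "1 + real j * ?l \<le> exp (real j * ?l)" by (rule exp_ge_add_one_self)
    also have "\<dots> = \<mu> ^ j" using assms by (simp add: exp_of_nat_mult)
    finally show "real j * ?l \<le> \<mu> ^ j - 1" by simp
  qed (use l in auto)
  finally show ?thesis .
qed

section \<open>The walk in integer arithmetic\<close>

text \<open>For \<open>Y \<le> 2 * H\<close> this is the minimum of \<open>Y\<close> and
  \<open>2 * H - Y\<close>, written with truncated subtraction so that the program evaluates it
  without a test.\<close>

definition fold_over :: "nat \<Rightarrow> nat \<Rightarrow> nat" where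
  "fold_over H Y = Y - 2 * (Y - H)"

definition crosses :: "nat \<Rightarrow> nat \<Rightarrow> nat \<Rightarrow> bool" where
  "crosses A Z H \<longleftrightarrow> A < H \<and> H < Z \<or> Z < H \<and> H < A"

text \<open>The factor 2 turns the critical point into the integer \<open>H\<close>, so comparing a
  point with 1/2 means comparing \<open>Y\<close> with \<open>H\<close>.\<close>

definition ratio :: "nat \<Rightarrow> nat \<Rightarrow> real" where
  "ratio Y H = real Y / (2 * real H)"

type_synonym walk = "nat \<times> nat \<times> nat \<times> nat \<times> nat"

text \<open>The two tests say that both halves are shorter than the current half-width, see
  \<open>ratio_compare\<close>. After the first cut \<open>A\<close> is the end on the critical
  orbit, so a new half-width is a distance between that orbit and 1/2.\<close>

fun next_cut :: "walk \<Rightarrow> nat \<times> nat" where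
  "next_cut (A, Z, H, W, K) =
     (if fold_over H Z * K > W * H \<and> fold_over H A * K > W * H then (fold_over H A, H) else (W, K))"

text \<open>A cut restarts from the segment between 1/2 and \<open>ratio W' K'\<close> and applies
  the map to it at once, so the scale becomes \<open>d * K'\<close>.\<close>

fun advance :: "nat \<Rightarrow> nat \<Rightarrow> walk \<Rightarrow> walk" where
  "advance c d (A, Z, H, W, K) =
     (if crosses A Z H
      then (case next_cut (A, Z, H, W, K) of (W', K') \<Rightarrow> (c * K', c * W', d * K', W', K'))
      else (c * fold_over H A, c * fold_over H Z, d * H, W, K))"

text \<open>At a cut, the half at \<open>Z\<close> is taken if it is at least as long as the current
  half-width, and otherwise the half at \<open>A\<close>, which is then long enough or supplies the
  new half-width itself. Without a cut both ends lie on one side, possibly one of them at 1/2, and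
  the midpoint decides.\<close>

fun side :: "walk \<Rightarrow> bool" where
  "side (A, Z, H, W, K) =
     (if crosses A Z H then (if fold_over H Z * K > W * H then A > H else Z > H) else A + Z > 2 * H)"

lemma ratio_fold:
  assumes "0 < H" "Y \<le> 2 * H"
  shows "ratio (fold_over H Y) H = 1/2 - \<bar>ratio Y H - 1/2\<bar>" "fold_over H Y \<le> H"
proof -
  show "fold_over H Y \<le> H" using assms by (auto simp: fold_over_def)
  consider "Y \<le> H" | "H \<le> Y" by linarith
  then show "ratio (fold_over H Y) H = 1/2 - \<bar>ratio Y H - 1/2\<bar>"
  proof cases
    case 1
    then have "ratio Y H \<le> 1/2" using assms by (auto simp: ratio_def field_simps)
    then show ?thesis using 1 by (simp add: fold_over_def)
  next
    case 2
    then have "ratio Y H \<ge> 1/2" using assms by (auto simp: ratio_def field_simps)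
    moreover have "real (fold_over H Y) = 2 * real H - real Y"
      using 2 assms by (auto simp: fold_over_def)
    ultimately show ?thesis using assms by (simp add: ratio_def field_simps)
  qed
qed

lemma ratio_half:
  assumes "0 < H"
  shows "ratio Y H < 1/2 \<longleftrightarrow> Y < H" "ratio Y H > 1/2 \<longleftrightarrow> Y > H"
  using assms by (auto simp: ratio_def field_simps)

locale slope =
  fixes c d :: nat and \<mu> :: real
  assumes mu: "\<mu> = real c / real d" "1 < \<mu>" "\<mu> < 2" and d: "0 < d"
begin

lemma tent_ratio:
  assumes "0 < H" "Y \<le> 2 * H"
  shows "tent \<mu> (ratio Y H) = ratio (c * fold_over H Y) (d * H)"
proof -
  have "tent \<mu> (ratio Y H) = \<mu> * ratio (fold_over H Y) H"
    unfolding ratio_fold[OF assms] by (auto simp: tent_def abs_if field_simps)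
  then show ?thesis by (simp add: mu(1) ratio_def)
qed

lemma c_le: "c \<le> 2 * d"
proof -
  have "real c < real (2 * d)" using mu(3) d unfolding mu(1) by (simp add: field_simps)
  then show ?thesis by linarith
qed

lemma scale_le: "Y \<le> H \<Longrightarrow> c * Y \<le> 2 * (d * H)"
  using mult_le_mono[OF c_le] by (metis mult.assoc)

lemma c_pos: "0 < c"
  using mu by (cases "c = 0") auto

text \<open>
  The walk carries the image of the current cylinder, the segment between the ratios of \<open>A\<close> and \<open>Z\<close>
  to \<open>2H\<close>, and the half-width \<open>1/2 - W/(2K)\<close> of the segment at the critical point that it restarts
  from.
\<close>

fun sound :: "real set \<Rightarrow> bool list \<Rightarrow> walk \<Rightarrow> bool" where
  "sound J w (A, Z, H, W, K) \<longleftrightarrow> 0 < H \<and> 0 < K \<and> A \<le> 2 * H \<and> Z \<le> 2 * H \<and> A \<noteq> Z \<and> W < K \<and>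
     segment (ratio A H) (ratio Z H) \<subseteq> image_of \<mu> J w"

lemma crosses_straddles:
  "0 < H \<Longrightarrow> crosses A Z H \<longleftrightarrow> straddles (ratio A H) (ratio Z H)"
  unfolding crosses_def straddles_def using ratio_half by metis

lemma next_cut_less:
  assumes "crosses A Z H" "next_cut (A, Z, H, W, K) = (W', K')" "0 < H" "0 < K" "W < K"
  shows "0 < K'" "W' < K'"
  using assms by (auto simp: crosses_def fold_over_def split: if_splits)

lemma ratio_compare:
  assumes "0 < H" "0 < K" "Y \<le> 2 * H"
  shows "fold_over H Y * K > W * H \<longleftrightarrow> \<bar>ratio Y H - 1/2\<bar> < 1/2 - ratio W K"
proof -
  have "fold_over H Y * K > W * H \<longleftrightarrow> ratio (fold_over H Y) H > ratio W K"
    using assms by (simp add: ratio_def field_simps flip: of_nat_mult)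
  then show ?thesis using ratio_fold(1)[OF assms(1,3)] by linarith
qed

text \<open>At a crossing only a part of the image is kept: the segment that leaves 1/2 into the
  chosen half with the new half-width. Its image does not depend on the side, by reflection, so it
  can be computed from \<open>ratio W' K'\<close>, which lies left of 1/2.\<close>

lemma sound_advance:
  assumes "sound J w s"
  shows "sound J (w @ [lastbit w \<noteq> side s]) (advance c d s)"
proof -
  obtain A Z H W K where s: "s = (A, Z, H, W, K)" by (metis prod_cases5)
  let ?a = "ratio A H" and ?z = "ratio Z H"
  have inv: "0 < H" "0 < K" "A \<le> 2 * H" "Z \<le> 2 * H" "A \<noteq> Z" "W < K"
    and V: "segment ?a ?z \<subseteq> image_of \<mu> J w"
    using assms by (auto simp: s)
  have mu0: "0 < \<mu>" using mu by simp
  show ?thesis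
  proof (cases "crosses A Z H")
    case False
    then have ns: "\<not> straddles ?a ?z" using crosses_straddles inv by blast
    have "?a \<noteq> ?z" using inv by (auto simp: ratio_def)
    then have "tent \<mu> ?a \<noteq> tent \<mu> ?z"
      using tent_dist[OF ns mu0] mu0 by auto
    then have ne: "c * fold_over H A \<noteq> c * fold_over H Z"
      using inv tent_ratio by metis
    have "tent \<mu> ` segment ?a ?z \<subseteq> image_of \<mu> J (w @ [lastbit w \<noteq> (A + Z > 2 * H)])"
    proof (rule image_of_extend[OF V])
      fix y assume y: "y \<in> segment ?a ?z"
      show "if A + Z > 2 * H then y > 1/2 else y < 1/2"
      proof (cases "A \<le> H \<and> Z \<le> H")
        case True
        then have "?a \<le> 1/2" "?z \<le> 1/2" using ratio_half(2)[OF inv(1)] by (meson not_le)+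
        moreover have "\<not> A + Z > 2 * H" using True by simp
        ultimately show ?thesis using y by (auto simp: segment_def)
      next
        case F: False
        then have ge: "A \<ge> H" "Z \<ge> H" using False by (auto simp: crosses_def)
        then have "?a \<ge> 1/2" "?z \<ge> 1/2" using ratio_half(1)[OF inv(1)] by (meson not_le)+
        moreover have "A + Z > 2 * H" using ge inv by linarith
        ultimately show ?thesis using y by (auto simp: segment_def)
      qed
    qed
    then have "segment (tent \<mu> ?a) (tent \<mu> ?z) \<subseteq> image_of \<mu> J (w @ [lastbit w \<noteq> (A + Z > 2 * H)])"
      by (rule order_trans[OF segment_tent[OF ns mu0]])
    then show ?thesis
      using False inv ne d scale_le ratio_fold(2)[OF inv(1)] by (simp add: s tent_ratio)
  next
    case True
    obtain W' K' where cut: "next_cut (A, Z, H, W, K) = (W', K')" by fastforce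
    have pos: "0 < K'" "W' < K'" using next_cut_less[OF True cut] inv by auto
    \<comment> \<open>The end of the chosen half.\<close>
    define b where "b = (if fold_over H Z * K > W * H then A else Z)"
    have bcase: "b = A \<or> b = Z" by (auto simp: b_def)
    have bH: "b \<noteq> H" "b \<le> 2 * H" using True bcase inv by (auto simp: crosses_def)
    have side: "side s \<longleftrightarrow> b > H" using True by (auto simp: s b_def)
    \<comment> \<open>If both halves are short, then \<open>b = A\<close> and equality holds by the
      choice of the new half-width. Otherwise the half at \<open>b\<close> is not shorter than the
      old one.\<close>
    have far: "1/2 - ratio W' K' \<le> \<bar>ratio b H - 1/2\<bar>"
    proof (cases "fold_over H Z * K > W * H \<and> fold_over H A * K > W * H")
      case True
      then show ?thesis using cut ratio_fold(1)[of H A] inv by (auto simp: b_def)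
    next
      case False
      then have "\<not> fold_over H b * K > W * H" by (auto simp: b_def)
      then show ?thesis using False cut ratio_compare[of H K b W] inv bH by auto
    qed
    \<comment> \<open>The point on the chosen side whose distance from 1/2 is the new
      half-width.\<close>
    define e where "e = (if b > H then 1 - ratio W' K' else ratio W' K')"
    have less: "ratio W' K' < 1/2" using ratio_half(1) pos by simp
    have str: "straddles ?a ?z" using True crosses_straddles inv by blast
    have half: "segment (1/2) e \<subseteq> segment ?a ?z"
    proof (cases "b > H")
      case T: True
      then have "ratio b H > 1/2" using ratio_half[OF inv(1)] by blast
      then have "1/2 < e" "e \<le> ratio b H" using far less unfolding e_def if_P[OF T] by linarith+
      then show ?thesis using str bcase by (auto simp: segment_def straddles_def)
    next
      case F: False
      then have "ratio b H < 1/2" using ratio_half[OF inv(1)] bH by (meson linorder_neqE_nat)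
      then have "ratio b H \<le> e" "e < 1/2" using F far less unfolding e_def if_not_P[OF F] by linarith+
      then show ?thesis using str bcase by (auto simp: segment_def straddles_def)
    qed
    have e: "\<bar>e - 1/2\<bar> = \<bar>ratio W' K' - 1/2\<bar>" by (auto simp: e_def)
    have "tent \<mu> ` segment (1/2) e \<subseteq> image_of \<mu> J (w @ [lastbit w \<noteq> side s])"
      by (intro image_of_extend[OF order_trans[OF half V]]) (use less in \<open>auto simp: side e_def segment_def\<close>)
    moreover have nse: "\<not> straddles (1/2) e" by (auto simp: straddles_def)
    ultimately have "segment (tent \<mu> (1/2)) (tent \<mu> e) \<subseteq> image_of \<mu> J (w @ [lastbit w \<noteq> side s])"
      using order_trans[OF segment_tent[OF nse mu0]] by simp
    moreover have "tent \<mu> (1/2) = ratio (c * K') (d * K')"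
      using pos d by (simp add: tent_def ratio_def mu(1))
    moreover have "tent \<mu> e = ratio (c * W') (d * K')"
      unfolding tent_reflect[OF e] using pos tent_ratio[of K' W'] by (simp add: fold_over_def)
    ultimately show ?thesis
      using True cut pos d c_pos scale_le[of K' K'] scale_le[of W' K'] by (simp add: s)
  qed
qed


text \<open>
  The second alternative is the phase after the first cut. There \<open>r\<close> is the return time that produced
  the current half-width \<open>\<delta>\<close>; a change of \<open>\<delta>\<close> at return time \<open>i\<close> forces \<open>i > r\<close>, \<open>\<mu>\<^sup>i < 2\<close> and
  \<open>\<delta>' > (\<mu>\<^sup>i - 1) \<delta>\<close>.
\<close>

fun frugal :: "nat \<Rightarrow> walk \<Rightarrow> bool" where
  "frugal q (A, Z, H, W, K) \<longleftrightarrow>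
     (\<exists>i. H = 2 ^ q * d ^ i \<and> \<bar>ratio A H - ratio Z H\<bar> = \<mu> ^ i / 2 ^ q \<and> K = 2 ^ q \<and> W = 2 ^ q - 1) \<or>
     (\<exists>i T r \<delta>. 1 \<le> i \<and> H = d ^ i * K \<and> K = 2 ^ q * d ^ T \<and> 2 * T \<le> r * (r + 1) \<and> \<mu> ^ r < 2 \<and>
        \<delta> = 1/2 - ratio W K \<and> (\<Prod>j=1..r. \<mu> ^ j - 1) / 2 ^ (q + 1) \<le> \<delta> \<and>
        ratio A H = (tent \<mu> ^^ i) (1/2) \<and> ratio Z H = (tent \<mu> ^^ i) (1/2 - \<delta>) \<and> unbroken \<mu> \<delta> i \<and>
        (r > 0 \<longrightarrow> unbroken \<mu> \<delta> r \<and> \<delta> = \<bar>(tent \<mu> ^^ r) (1/2) - 1/2\<bar>))"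

text \<open>Return times may jump from \<open>r\<close> to \<open>i\<close>. The factors skipped in
  between lie between 0 and 1 because \<open>\<mu> ^ i < 2\<close>, so including them only lowers
  the product.\<close>

lemma prod_power_shrink:
  assumes "r < i" "\<mu> ^ i < 2"
  shows "(\<Prod>j=1..i. \<mu> ^ j - 1) \<le> (\<mu> ^ i - 1) * (\<Prod>j=1..r. \<mu> ^ j - 1)"
proof -
  have f: "0 \<le> \<mu> ^ j - 1" "\<mu> ^ j - 1 \<le> 1" if "j \<le> i" for j
    using power_increasing[OF that, of \<mu>] one_le_power[of \<mu> j] mu(2) assms(2) by linarith+
  obtain k where k: "i = Suc k" using assms(1) by (cases i) auto
  have "{1..k} = {1..r} \<union> {Suc r..k}" using assms(1) k by auto
  then have "(\<Prod>j=1..k. \<mu> ^ j - 1) = (\<Prod>j=1..r. \<mu> ^ j - 1) * (\<Prod>j=Suc r..k. \<mu> ^ j - 1)"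
    by (simp add: prod.union_disjoint)
  also have "\<dots> \<le> (\<Prod>j=1..r. \<mu> ^ j - 1) * 1"
    using f k assms(1) by (intro mult_left_mono prod_le_1 prod_nonneg) auto
  finally have "(\<Prod>j=1..k. \<mu> ^ j - 1) \<le> (\<Prod>j=1..r. \<mu> ^ j - 1)" by simp
  then have "(\<mu> ^ i - 1) * (\<Prod>j=1..k. \<mu> ^ j - 1) \<le> (\<mu> ^ i - 1) * (\<Prod>j=1..r. \<mu> ^ j - 1)"
    using f[of i] by (intro mult_left_mono) auto
  then show ?thesis by (simp add: k mult.commute)
qed

lemma restart:
  assumes "0 < K" "W < K"
  shows "ratio (c * K) (d * K) = (tent \<mu> ^^ 1) (1/2)"
    and "ratio (c * W) (d * K) = (tent \<mu> ^^ 1) (1/2 - (1/2 - ratio W K))"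
proof -
  show "ratio (c * K) (d * K) = (tent \<mu> ^^ 1) (1/2)"
    using assms d by (simp add: tent_def ratio_def mu(1))
  show "ratio (c * W) (d * K) = (tent \<mu> ^^ 1) (1/2 - (1/2 - ratio W K))"
    using tent_ratio[of K W] assms by (simp add: fold_over_def)
qed

lemma frugal_restart:
  assumes "0 < K" "W < K" "K = 2 ^ q * d ^ T" "2 * T \<le> r * (r + 1)" "\<mu> ^ r < 2"
    and "(\<Prod>j=1..r. \<mu> ^ j - 1) / 2 ^ (q + 1) \<le> 1/2 - ratio W K"
    and "r > 0 \<Longrightarrow> unbroken \<mu> (1/2 - ratio W K) r"
    and "r > 0 \<Longrightarrow> 1/2 - ratio W K = \<bar>(tent \<mu> ^^ r) (1/2) - 1/2\<bar>"
  shows "frugal q (c * K, c * W, d * K, W, K)"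
proof -
  have "unbroken \<mu> (1/2 - ratio W K) 1" by (simp add: unbroken_def)
  moreover have "d * K = d ^ 1 * K" by simp
  ultimately show ?thesis
    unfolding frugal.simps using assms(3-) restart[OF assms(1,2)] by blast
qed

lemma straddles_dist:
  "straddles a z \<Longrightarrow> \<bar>a - z\<bar> = \<bar>a - 1/2\<bar> + \<bar>z - 1/2\<bar>"
  unfolding straddles_def by linarith

text \<open>Only a cut that changes the half-width needs an argument. Gliding raises
  \<open>i\<close> by one, and a cut that keeps \<open>W\<close> and \<open>K\<close> resets
  \<open>i\<close> to 1 with the same \<open>T\<close> and \<open>r\<close>.\<close>

lemma frugal_advance:
  assumes "sound J w s" "frugal q s"
  shows "frugal q (advance c d s)"
proof -
  obtain A Z H W K where s: "s = (A, Z, H, W, K)" by (metis prod_cases5)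
  let ?a = "ratio A H" and ?z = "ratio Z H"
  have inv: "0 < H" "0 < K" "A \<le> 2 * H" "Z \<le> 2 * H" "A \<noteq> Z" "W < K"
    using assms by (auto simp: s)
  have mu0: "0 < \<mu>" using mu by simp
  show ?thesis
  proof (cases "crosses A Z H")
    case False
    then have ns: "\<not> straddles ?a ?z" using crosses_straddles inv by blast
    have adv: "advance c d s = (c * fold_over H A, c * fold_over H Z, d * H, W, K)"
      using False by (simp add: s)
    have dist: "\<bar>tent \<mu> ?a - tent \<mu> ?z\<bar> = \<mu> * \<bar>?a - ?z\<bar>" by (rule tent_dist[OF ns mu0])
    from assms(2) consider
      (a) i where "H = 2 ^ q * d ^ i" "\<bar>?a - ?z\<bar> = \<mu> ^ i / 2 ^ q" "K = 2 ^ q" "W = 2 ^ q - 1"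
    | (b) i T r \<delta> where "1 \<le> i" "H = d ^ i * K" "K = 2 ^ q * d ^ T" "2 * T \<le> r * (r + 1)" "\<mu> ^ r < 2"
        "\<delta> = 1/2 - ratio W K" "(\<Prod>j=1..r. \<mu> ^ j - 1) / 2 ^ (q + 1) \<le> \<delta>"
        "?a = (tent \<mu> ^^ i) (1/2)" "?z = (tent \<mu> ^^ i) (1/2 - \<delta>)" "unbroken \<mu> \<delta> i"
        "r > 0 \<longrightarrow> unbroken \<mu> \<delta> r \<and> \<delta> = \<bar>(tent \<mu> ^^ r) (1/2) - 1/2\<bar>"
      unfolding s frugal.simps by blast
    then show ?thesis
    proof cases
      case a
      have "\<bar>ratio (c * fold_over H A) (d * H) - ratio (c * fold_over H Z) (d * H)\<bar> = \<mu> ^ Suc i / 2 ^ q"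
        using dist a(2) inv by (simp add: tent_ratio)
      moreover have "d * H = 2 ^ q * d ^ Suc i" using a by simp
      ultimately show ?thesis unfolding adv frugal.simps using a by blast
    next
      case b
      have "unbroken \<mu> \<delta> (Suc i)"
        using b(8-10) ns unfolding unbroken_def by (metis less_Suc_eq)
      moreover have "ratio (c * fold_over H A) (d * H) = (tent \<mu> ^^ Suc i) (1/2)"
        "ratio (c * fold_over H Z) (d * H) = (tent \<mu> ^^ Suc i) (1/2 - \<delta>)"
        using inv b(8,9) by (simp_all flip: tent_ratio)
      moreover have "d * H = d ^ Suc i * K" "1 \<le> Suc i" using b by simp_all
      ultimately show ?thesis unfolding adv frugal.simps using b(3-7,11) by blast
    qed
  next
    case True
    then have str: "straddles ?a ?z" using crosses_straddles inv by blast
    note dist = straddles_dist[OF str]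
    from assms(2) consider
      (a) i where "H = 2 ^ q * d ^ i" "\<bar>?a - ?z\<bar> = \<mu> ^ i / 2 ^ q" "K = 2 ^ q" "W = 2 ^ q - 1"
    | (b) i T r \<delta> where "1 \<le> i" "H = d ^ i * K" "K = 2 ^ q * d ^ T" "2 * T \<le> r * (r + 1)" "\<mu> ^ r < 2"
        "\<delta> = 1/2 - ratio W K" "(\<Prod>j=1..r. \<mu> ^ j - 1) / 2 ^ (q + 1) \<le> \<delta>"
        "?a = (tent \<mu> ^^ i) (1/2)" "?z = (tent \<mu> ^^ i) (1/2 - \<delta>)" "unbroken \<mu> \<delta> i"
        "r > 0 \<longrightarrow> unbroken \<mu> \<delta> r \<and> \<delta> = \<bar>(tent \<mu> ^^ r) (1/2) - 1/2\<bar>"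
      unfolding s frugal.simps by blast
    then show ?thesis
    proof cases
      case a
      have \<delta>: "1/2 - ratio W K = 1 / 2 ^ (q + 1)"
        using a by (simp add: ratio_def of_nat_diff field_simps)
      \<comment> \<open>The width has not dropped below its initial value, so one half has length at
        least \<open>1 / 2 ^ (q + 1)\<close>, the half-width prepared at the start. The first cut
        thus keeps \<open>W\<close> and \<open>K\<close>, and no power of \<open>d\<close> enters
        \<open>K\<close>.\<close>
      have "\<mu> ^ i / 2 ^ q \<ge> 1 / 2 ^ q" using mu by (intro divide_right_mono one_le_power) auto
      then have "1 / 2 ^ q \<le> \<bar>?a - 1/2\<bar> + \<bar>?z - 1/2\<bar>" using dist a(2) by simp
      moreover have "1 / 2 ^ q = 2 * (1 / 2 ^ (q + 1) :: real)" by simp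
      ultimately have "\<bar>?a - 1/2\<bar> \<ge> 1 / 2 ^ (q + 1) \<or> \<bar>?z - 1/2\<bar> \<ge> 1 / 2 ^ (q + 1)" by argo
      then have "next_cut (A, Z, H, W, K) = (W, K)"
        using ratio_compare[of H K _ W] inv \<delta> by auto
      then have adv: "advance c d s = (c * K, c * W, d * K, W, K)"
        using True by (simp add: s)
      have "(\<Prod>j=1..0. \<mu> ^ j - 1) / 2 ^ (q + 1) \<le> 1/2 - ratio W K" using \<delta> by simp
      then show ?thesis
        unfolding adv using a by (intro frugal_restart[OF inv(2,6), of q 0 0]) simp_all
    next
      case b
      show ?thesis
      proof (cases "fold_over H Z * K > W * H \<and> fold_over H A * K > W * H")
        case False
        then have adv: "advance c d s = (c * K, c * W, d * K, W, K)"
          using True by (auto simp: s)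
        show ?thesis
          unfolding adv using b(7,11)[unfolded b(6)]
          by (intro frugal_restart[OF inv(2,6) b(3-5)]) blast+
      next
        case both: True
        let ?W = "fold_over H A" and ?\<delta> = "\<bar>?a - 1/2\<bar>"
        have adv: "advance c d s = (c * H, c * ?W, d * H, ?W, H)"
          using True both by (auto simp: s)
        have W': "?W < H" using True inv by (auto simp: crosses_def fold_over_def)
        have \<delta>': "?\<delta> = 1/2 - ratio ?W H" using ratio_fold(1)[of H A] inv by simp
        have lt: "?\<delta> < \<delta>" "\<bar>?z - 1/2\<bar> < \<delta>"
          using both ratio_compare[of H K _ W] inv b(6) by auto
        have \<delta>0: "0 < \<delta>" using lt by linarith
        have wid: "\<bar>?a - ?z\<bar> = \<mu> ^ i * \<delta>"
          using unbroken_width[OF b(10,1) _ mu0] \<delta>0 b(8,9) by simp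
        have "\<mu> ^ i * \<delta> < 2 * \<delta>" using wid dist lt by linarith
        then have small: "\<mu> ^ i < 2" using \<delta>0 by simp
        \<comment> \<open>A cut before time \<open>r\<close> contradicts \<open>unbroken\<close>. At
          time \<open>r\<close> the end \<open>A\<close> would lie at distance exactly \<delta> from
          1/2, not below it.\<close>
        have "r < i"
        proof (cases "r = 0")
          case False
          then have r: "unbroken \<mu> \<delta> r" "\<delta> = \<bar>(tent \<mu> ^^ r) (1/2) - 1/2\<bar>" using b(11) by auto
          have "\<not> i < r" using r(1) str b(1,8,9) unfolding unbroken_def by metis
          moreover have "i \<noteq> r" using r(2) lt(1) b(8) by auto
          ultimately show ?thesis by simp
        qed (use b in simp)
        have "(\<mu> ^ i - 1) * \<delta> \<le> ?\<delta>" using wid dist lt by (simp add: algebra_simps)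
        moreover have "(\<Prod>j=1..i. \<mu> ^ j - 1) / 2 ^ (q + 1) \<le> (\<mu> ^ i - 1) * ((\<Prod>j=1..r. \<mu> ^ j - 1) / 2 ^ (q + 1))"
          using divide_right_mono[OF prod_power_shrink[OF \<open>r < i\<close> small], of "2 ^ (q + 1)"] by simp
        moreover have "(\<mu> ^ i - 1) * ((\<Prod>j=1..r. \<mu> ^ j - 1) / 2 ^ (q + 1)) \<le> (\<mu> ^ i - 1) * \<delta>"
          using b(7) mu(2) by (intro mult_left_mono) auto
        ultimately have low: "(\<Prod>j=1..i. \<mu> ^ j - 1) / 2 ^ (q + 1) \<le> ?\<delta>" by linarith
        have unb': "unbroken \<mu> ?\<delta> i" using unbroken_mono[OF b(10)] lt by simp
        \<comment> \<open>The exponent \<open>T\<close> collects distinct return times up to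
          \<open>r\<close> and is bounded by the sum of all numbers up to \<open>r\<close>. The new
          time \<open>i > r\<close> fits into the sum up to \<open>i\<close>.\<close>
        have "r * (r + 1) + 2 * i \<le> i * (i + 1)"
        proof -
          have "r * (r + 1) \<le> (i - 1) * i" using \<open>r < i\<close> by (intro mult_le_mono) auto
          then show ?thesis using b(1) by (cases i) (auto simp: algebra_simps)
        qed
        then have T: "2 * (T + i) \<le> i * (i + 1)" using b(4) by simp
        have H: "H = 2 ^ q * d ^ (T + i)" using b by (simp add: power_add)
        show ?thesis
          unfolding adv using low unb' T H small \<delta>' b(8)
          by (intro frugal_restart[OF inv(1) W', of q "T + i" i]) simp_all
      qed
    qed
  qed
qed

text \<open>In the second phase the exponent is \<open>T + i\<close>. Here
  \<open>T \<le> r * r\<close> and \<open>r * ln \<mu> \<le> ln 2 \<le> 1\<close>, while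
  \<open>\<mu> ^ i * \<delta> \<le> 1\<close> bounds \<open>i\<close> by
  \<open>-ln \<delta> / ln \<mu>\<close>. Each of the two contributes one to the constant 2 in front
  of the inverse square; the factor \<open>1 / 2 ^ (q + 1)\<close> in \<delta> gives
  \<open>q + 1\<close>.\<close>

lemma frugal_bound:
  assumes "sound J w (A, Z, H, W, K)" "frugal q (A, Z, H, W, K)"
  shows "K \<le> H" "\<exists>e. H = 2 ^ q * d ^ e \<and> real e \<le> 2 / (ln \<mu>)\<^sup>2 + (real q + 1) / ln \<mu>"
proof -
  let ?l = "ln \<mu>"
  have l: "0 < ?l" using mu by simp
  have mu0: "0 < \<mu>" using mu by simp
  have inv: "0 < H" "0 < K" "A \<le> 2 * H" "Z \<le> 2 * H" "A \<noteq> Z" "W < K"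
    using assms by auto
  have unit: "ratio A H \<in> {0..1}" "ratio Z H \<in> {0..1}"
    using inv by (auto simp: ratio_def field_simps)
  have dist: "\<bar>ratio A H - ratio Z H\<bar> \<le> 1" using unit by (simp add: abs_le_iff)
  have ln2: "ln 2 \<le> (1::real)" using ln_le_minus_one[of "2::real"] by simp
  have time: "real i * ?l \<le> - ln \<epsilon>" if "\<mu> ^ i * \<epsilon> \<le> 1" "0 < \<epsilon>" for i \<epsilon>
  proof -
    have "ln (\<mu> ^ i * \<epsilon>) \<le> 0" using that mu0 by simp
    then show ?thesis using that mu0 by (simp add: ln_mult ln_realpow)
  qed
  have "K \<le> H \<and> (\<exists>e. H = 2 ^ q * d ^ e \<and> real e * ?l\<^sup>2 \<le> 2 + (real q + 1) * ?l)"
    using assms(2) unfolding frugal.simps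
  proof (elim disjE exE conjE)
    fix i assume a: "H = 2 ^ q * d ^ i" "\<bar>ratio A H - ratio Z H\<bar> = \<mu> ^ i / 2 ^ q" "K = 2 ^ q"
    have "\<mu> ^ i * (1 / 2 ^ q) \<le> 1" using a(2) dist by simp
    then have "real i * ?l \<le> real q * ln 2" using time[of i "1 / 2 ^ q"] by (simp add: ln_div ln_realpow)
    also have "\<dots> \<le> real q + 1" using ln2 mult_left_le[of "ln 2" "real q"] by simp
    finally have "real i * ?l * ?l \<le> (real q + 1) * ?l" using l by (intro mult_right_mono) auto
    then have "real i * ?l\<^sup>2 \<le> 2 + (real q + 1) * ?l" by (simp add: power2_eq_square mult.assoc)
    then show ?thesis using a d by auto
  next
    fix i T r \<delta>
    assume b: "1 \<le> i" "H = d ^ i * K" "K = 2 ^ q * d ^ T" "2 * T \<le> r * (r + 1)" "\<mu> ^ r < 2"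
        "(\<Prod>j=1..r. \<mu> ^ j - 1) / 2 ^ (q + 1) \<le> \<delta>"
        "ratio A H = (tent \<mu> ^^ i) (1/2)" "ratio Z H = (tent \<mu> ^^ i) (1/2 - \<delta>)" "unbroken \<mu> \<delta> i"
    have "exp (- (1 / ?l)) / 2 ^ (q + 1) \<le> (\<Prod>j=1..r. \<mu> ^ j - 1) / 2 ^ (q + 1)"
      using prod_power_minus_one_ge[OF mu(2)] by (intro divide_right_mono) auto
    then have low: "exp (- (1 / ?l)) / 2 ^ (q + 1) \<le> \<delta>" using b(6) by linarith
    moreover have pos: "0 < exp (- (1 / ?l)) / 2 ^ (q + 1)" by simp
    ultimately have \<delta>0: "0 < \<delta>" by linarith
    have "ln (exp (- (1 / ?l)) / 2 ^ (q + 1)) \<le> ln \<delta>" using low pos \<delta>0 by (subst ln_le_cancel_iff) auto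
    then have "- ln \<delta> \<le> 1 / ?l + real (q + 1) * ln 2" by (simp add: ln_div ln_realpow del: power_Suc)
    also have "\<dots> \<le> 1 / ?l + (real q + 1)" using ln2 mult_left_le[of "ln 2" "real q + 1"] by (simp add: add.commute)
    finally have \<delta>: "- ln \<delta> \<le> 1 / ?l + (real q + 1)" .
    have "\<mu> ^ i * \<delta> \<le> 1" using unbroken_width[OF b(9,1) _ mu0] \<delta>0 b(7,8) dist by simp
    then have "real i * ?l \<le> 1 / ?l + (real q + 1)" using time[of i \<delta>] \<delta> \<delta>0 by simp
    then have "real i * ?l * ?l \<le> (1 / ?l + (real q + 1)) * ?l" using l by (intro mult_right_mono) auto
    then have i: "real i * ?l\<^sup>2 \<le> 1 + (real q + 1) * ?l" using l by (simp add: power2_eq_square algebra_simps)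
    have "r \<le> r * r" by simp
    moreover have "r * (r + 1) = r * r + r" by simp
    ultimately have "T \<le> r * r" using b(4) by linarith
    then have "real T * ?l\<^sup>2 \<le> (real r * ?l)\<^sup>2"
      unfolding power_mult_distrib by (intro mult_right_mono) (auto simp: power2_eq_square simp flip: of_nat_mult)
    moreover have "real r * ?l \<le> 1"
    proof -
      have "ln (\<mu> ^ r) \<le> ln 2" using b(5) mu0 by (subst ln_le_cancel_iff) auto
      then show ?thesis using ln2 mu0 by (simp add: ln_realpow)
    qed
    then have "(real r * ?l)\<^sup>2 \<le> 1" using l by (intro power_le_one) auto
    ultimately have "real (T + i) * ?l\<^sup>2 \<le> 2 + (real q + 1) * ?l" using i by (simp add: algebra_simps)
    moreover have "H = 2 ^ q * d ^ (T + i)" using b by (simp add: power_add)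
    moreover have "K \<le> H" using b(2) d by simp
    ultimately show ?thesis by blast
  qed
  then obtain e where "K \<le> H" "H = 2 ^ q * d ^ e" and e: "real e * ?l\<^sup>2 \<le> 2 + (real q + 1) * ?l" by blast
  moreover have "real e \<le> (2 + (real q + 1) * ?l) / ?l\<^sup>2" using e l by (simp add: pos_le_divide_eq)
  then have "real e \<le> 2 / ?l\<^sup>2 + (real q + 1) / ?l" using l by (simp add: add_divide_distrib power2_eq_square)
  ultimately show "K \<le> H" "\<exists>e. H = 2 ^ q * d ^ e \<and> real e \<le> 2 / (ln \<mu>)\<^sup>2 + (real q + 1) / ln \<mu>" by blast+
qed

end

section \<open>Arithmetic with counters\<close>

lemma while_iterate:
  assumes "\<And>i. i < m \<Longrightarrow> holds I b (S i) \<and> big N I c (S i) (S (Suc i))" "\<not> holds I b (S m)"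
  shows "big N I (While b c) (S 0) (S m)"
proof -
  have "big N I (While b c) (S (m - i)) (S m)" if "i \<le> m" for i
    using that
  proof (induction i)
    case 0
    then show ?case using assms(2) by (auto intro: big.WhileFalse)
  next
    case (Suc i)
    then have "big N I c (S (m - Suc i)) (S (m - i))" "holds I b (S (m - Suc i))"
      using assms(1)[of "m - Suc i"] by (auto simp: Suc_diff_Suc)
    then show ?case using Suc by (auto intro: big.WhileTrue)
  qed
  from this[of m] show ?thesis by simp
qed

definition transfer :: "'v \<Rightarrow> 'v \<Rightarrow> 'v com" where
  "transfer x y = While (Pos x) (Dec x ;; Inc y)"

definition copy :: "'v \<Rightarrow> 'v \<Rightarrow> 'v \<Rightarrow> 'v com" where
  "copy x y t = While (Pos x) (Dec x ;; Inc y ;; Inc t) ;; transfer t x"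

definition clear :: "'v \<Rightarrow> 'v com" where
  "clear x = While (Pos x) (Dec x)"

definition subtract :: "'v \<Rightarrow> 'v \<Rightarrow> 'v com" where
  "subtract x y = While (Pos x) (Dec x ;; IfElse (Pos y) (Dec y) Skip)"

lemma big_transfer:
  assumes "x \<noteq> y" "s y + s x \<le> N"
  shows "big N I (transfer x y) (s, hs, out) (s(x := 0, y := s y + s x), hs, out)"
proof -
  let ?S = "\<lambda>i. (s(x := s x - i, y := s y + i), hs, out)"
  have "big N I (While (Pos x) (Dec x ;; Inc y)) (?S 0) (?S (s x))"
  proof (rule while_iterate)
    fix i assume i: "i < s x"
    let ?s = "s(x := s x - i, y := s y + i)"
    have 1: "big N I (Dec x) (?s, hs, out) (?s(x := ?s x - 1), hs, out)"
      using i assms by (intro big.Dec) auto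
    have 2: "big N I (Inc y) (?s(x := ?s x - 1), hs, out)
        ((?s(x := ?s x - 1))(y := Suc ((?s(x := ?s x - 1)) y)), hs, out)"
      using i assms by (intro big.Inc) auto
    have "(?s(x := ?s x - 1))(y := Suc ((?s(x := ?s x - 1)) y)) = s(x := s x - Suc i, y := s y + Suc i)"
      using assms by (auto simp: fun_eq_iff)
    with big.Seq[OF 1 2] i assms(1) show "holds I (Pos x) (?S i) \<and> big N I (Dec x ;; Inc y) (?S i) (?S (Suc i))"
      by simp
  qed (use assms in auto)
  then show ?thesis by (simp add: transfer_def)
qed

lemma big_copy:
  assumes "x \<noteq> y" "x \<noteq> t" "y \<noteq> t" "s t = 0" "s y + s x \<le> N"
  shows "big N I (copy x y t) (s, hs, out) (s(y := s y + s x), hs, out)"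
proof -
  let ?S = "\<lambda>i. (s(x := s x - i, y := s y + i, t := i), hs, out)"
  have "big N I (While (Pos x) (Dec x ;; Inc y ;; Inc t)) (?S 0) (?S (s x))"
  proof (rule while_iterate)
    fix i assume i: "i < s x"
    let ?s = "s(x := s x - i, y := s y + i, t := i)"
    let ?s1 = "?s(x := ?s x - 1)"
    let ?s2 = "?s1(y := Suc (?s1 y))"
    have 1: "big N I (Dec x) (?s, hs, out) (?s1, hs, out)"
      using i assms by (intro big.Dec) auto
    have 2: "big N I (Inc y) (?s1, hs, out) (?s2, hs, out)"
      using i assms by (intro big.Inc) auto
    have 3: "big N I (Inc t) (?s2, hs, out) (?s2(t := Suc (?s2 t)), hs, out)"
      using i assms by (intro big.Inc) auto
    have "?s2(t := Suc (?s2 t)) = s(x := s x - Suc i, y := s y + Suc i, t := Suc i)"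
      using assms by (auto simp: fun_eq_iff)
    with big.Seq[OF 1 big.Seq[OF 2 3]] i assms(1,2)
    show "holds I (Pos x) (?S i) \<and> big N I (Dec x ;; Inc y ;; Inc t) (?S i) (?S (Suc i))"
      by simp
  qed (use assms in auto)
  moreover have "?S 0 = (s, hs, out)" using assms(4) by (auto simp: fun_eq_iff)
  moreover have "big N I (transfer t x) (?S (s x)) (s(y := s y + s x), hs, out)"
  proof -
    let ?s = "s(x := s x - s x, y := s y + s x, t := s x)"
    have "?s(t := 0, x := ?s x + ?s t) = s(y := s y + s x)"
      using assms by (auto simp: fun_eq_iff)
    then show ?thesis using big_transfer[of t x ?s N I hs out] assms by simp
  qed
  ultimately show ?thesis unfolding copy_def by (auto intro: big.Seq)
qed

lemma big_clear: "big N I (clear x) (s, hs, out) (s(x := 0), hs, out)"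
proof -
  let ?S = "\<lambda>i. (s(x := s x - i), hs, out)"
  have "big N I (While (Pos x) (Dec x)) (?S 0) (?S (s x))"
  proof (rule while_iterate)
    fix i assume i: "i < s x"
    then show "holds I (Pos x) (?S i) \<and> big N I (Dec x) (?S i) (?S (Suc i))"
      using big.Dec[of "s(x := s x - i)" x N I hs out] by simp
  qed auto
  then show ?thesis by (simp add: clear_def)
qed

lemma big_subtract:
  assumes "x \<noteq> y"
  shows "big N I (subtract x y) (s, hs, out) (s(x := 0, y := s y - s x), hs, out)"
proof -
  let ?S = "\<lambda>i. (s(x := s x - i, y := s y - i), hs, out)"
  have "big N I (While (Pos x) (Dec x ;; IfElse (Pos y) (Dec y) Skip)) (?S 0) (?S (s x))"
  proof (rule while_iterate)
    fix i assume i: "i < s x"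
    let ?s = "s(x := s x - i, y := s y - i)"
    let ?s1 = "?s(x := ?s x - 1)"
    have 1: "big N I (Dec x) (?s, hs, out) (?s1, hs, out)"
      using i assms by (intro big.Dec) auto
    have eq: "?s1(y := ?s1 y - 1) = s(x := s x - Suc i, y := s y - Suc i)"
      using assms by (auto simp: fun_eq_iff)
    have 2: "big N I (IfElse (Pos y) (Dec y) Skip) (?s1, hs, out) (?s1(y := ?s1 y - 1), hs, out)"
    proof (cases "0 < ?s1 y")
      case True
      then show ?thesis by (intro big.IfTrue big.Dec) auto
    next
      case False
      then have "?s1(y := ?s1 y - 1) = ?s1" by (auto simp: fun_eq_iff)
      then show ?thesis using False by (auto intro!: big.IfFalse big.Skip simp del: fun_upd_apply)
    qed
    show "holds I (Pos x) (?S i) \<and> big N I (Dec x ;; IfElse (Pos y) (Dec y) Skip) (?S i) (?S (Suc i))"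
      using big.Seq[OF 1 2] i assms unfolding eq by simp
  qed (use assms in auto)
  then show ?thesis by (simp add: subtract_def)
qed

text \<open>The temporaries \<open>Tmp\<close> serve as the evaluation stack for expressions.\<close>

datatype name = First | Second | Scale | Cut | Cut_Scale | Numer | Denom | Todo | Parity | Flag

datatype reg = Var name | Tmp nat

datatype expr = V name | Num nat | Plus expr expr | Minus expr expr | Times expr expr

fun eval :: "expr \<Rightarrow> (name \<Rightarrow> nat) \<Rightarrow> nat" where
  "eval (V x) \<rho> = \<rho> x"
| "eval (Num n) \<rho> = n"
| "eval (Plus e f) \<rho> = eval e \<rho> + eval f \<rho>"
| "eval (Minus e f) \<rho> = eval e \<rho> - eval f \<rho>"
| "eval (Times e f) \<rho> = eval e \<rho> * eval f \<rho>"

fun fits :: "nat \<Rightarrow> expr \<Rightarrow> (name \<Rightarrow> nat) \<Rightarrow> bool" where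
  "fits N (Plus e f) \<rho> \<longleftrightarrow> fits N e \<rho> \<and> fits N f \<rho> \<and> eval e \<rho> + eval f \<rho> \<le> N"
| "fits N (Minus e f) \<rho> \<longleftrightarrow> fits N e \<rho> \<and> fits N f \<rho>"
| "fits N (Times e f) \<rho> \<longleftrightarrow> fits N e \<rho> \<and> fits N f \<rho> \<and> eval e \<rho> * eval f \<rho> \<le> N"
| "fits N e \<rho> \<longleftrightarrow> eval e \<rho> \<le> N"

fun incs :: "nat \<Rightarrow> reg \<Rightarrow> reg com" where
  "incs 0 x = Skip"
| "incs (Suc n) x = Inc x ;; incs n x"

text \<open>The value is left in \<open>Tmp k\<close>. All temporaries from \<open>k\<close> on have
  to be zero before, and those above \<open>k\<close> are zero again afterwards.\<close>

fun evaluate :: "nat \<Rightarrow> expr \<Rightarrow> reg com" where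
  "evaluate k (V x) = copy (Var x) (Tmp k) (Tmp (k + 1))"
| "evaluate k (Num n) = incs n (Tmp k)"
| "evaluate k (Plus e f) = evaluate k e ;; evaluate (k + 1) f ;; transfer (Tmp (k + 1)) (Tmp k)"
| "evaluate k (Minus e f) = evaluate k e ;; evaluate (k + 1) f ;; subtract (Tmp (k + 1)) (Tmp k)"
| "evaluate k (Times e f) = evaluate k e ;; evaluate (k + 1) f ;;
     While (Pos (Tmp k)) (Dec (Tmp k) ;; copy (Tmp (k + 1)) (Tmp (k + 2)) (Tmp (k + 3))) ;;
     clear (Tmp (k + 1)) ;; transfer (Tmp (k + 2)) (Tmp k)"

definition assign :: "name \<Rightarrow> expr \<Rightarrow> reg com" where
  "assign x e = evaluate 0 e ;; clear (Var x) ;; transfer (Tmp 0) (Var x)"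

lemma fits_le: "fits N e \<rho> \<Longrightarrow> eval e \<rho> \<le> N"
  by (induction e) auto

lemma big_incs:
  "s x + n \<le> N \<Longrightarrow> big N I (incs n x) (s, hs, out) (s(x := s x + n), hs, out)"
proof (induction n arbitrary: s)
  case 0
  then show ?case by (simp add: big.Skip)
next
  case (Suc n)
  have "big N I (incs n x) (s(x := Suc (s x)), hs, out) (s(x := s x + Suc n), hs, out)"
    using Suc.IH[of "s(x := Suc (s x))"] Suc.prems by (simp add: fun_upd_same del: fun_upd_apply)
  moreover have "big N I (Inc x) (s, hs, out) (s(x := Suc (s x)), hs, out)"
    using Suc.prems by (intro big.Inc) simp
  ultimately show ?case by (metis big.Seq incs.simps(2))
qed

definition env_of :: "(reg \<Rightarrow> nat) \<Rightarrow> name \<Rightarrow> nat" where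
  "env_of s x = s (Var x)"

lemma env_of_update [simp]: "env_of (s(Tmp k := a)) = env_of s"
  by (auto simp: env_of_def)

lemma big_evaluate:
  assumes "fits N e (env_of s)" "\<And>j. k \<le> j \<Longrightarrow> s (Tmp j) = 0"
  shows "big N I (evaluate k e) (s, hs, out) (s(Tmp k := eval e (env_of s)), hs, out)"
  using assms
proof (induction e arbitrary: k s)
  case (V x)
  then show ?case using big_copy[of "Var x" "Tmp k" "Tmp (k + 1)" s N I hs out] by (simp add: env_of_def del: fun_upd_apply)
next
  case (Num n)
  then show ?case using big_incs[of s "Tmp k" n N I hs out] by (simp del: fun_upd_apply)
next
  case (Plus e f)
  let ?a = "eval e (env_of s)" and ?b = "eval f (env_of s)"
  let ?s1 = "s(Tmp k := ?a)"
  let ?s2 = "?s1(Tmp (k + 1) := ?b)"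
  have 1: "big N I (evaluate k e) (s, hs, out) (?s1, hs, out)"
    by (rule Plus.IH(1)) (use Plus.prems in auto)
  have "?s1 (Tmp j) = 0" if "k + 1 \<le> j" for j
    using Plus.prems(2)[of j] that by simp
  then have 2: "big N I (evaluate (k + 1) f) (?s1, hs, out) (?s2, hs, out)"
    using Plus.IH(2)[of ?s1 "k + 1"] Plus.prems(1) by (simp del: fun_upd_apply)
  have "?s2(Tmp (k + 1) := 0, Tmp k := ?s2 (Tmp k) + ?s2 (Tmp (k + 1))) = s(Tmp k := ?a + ?b)"
    using Plus.prems(2)[of "k + 1"] by (auto simp: fun_eq_iff)
  then have 3: "big N I (transfer (Tmp (k + 1)) (Tmp k)) (?s2, hs, out) (s(Tmp k := ?a + ?b), hs, out)"
    using big_transfer[of "Tmp (k + 1)" "Tmp k" ?s2 N I hs out] Plus.prems by simp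
  show ?case using big.Seq[OF 1 big.Seq[OF 2 3]] by (simp del: fun_upd_apply)
next
  case (Minus e f)
  let ?a = "eval e (env_of s)" and ?b = "eval f (env_of s)"
  let ?s1 = "s(Tmp k := ?a)"
  let ?s2 = "?s1(Tmp (k + 1) := ?b)"
  have 1: "big N I (evaluate k e) (s, hs, out) (?s1, hs, out)"
    by (rule Minus.IH(1)) (use Minus.prems in auto)
  have "?s1 (Tmp j) = 0" if "k + 1 \<le> j" for j
    using Minus.prems(2)[of j] that by simp
  then have 2: "big N I (evaluate (k + 1) f) (?s1, hs, out) (?s2, hs, out)"
    using Minus.IH(2)[of ?s1 "k + 1"] Minus.prems(1) by (simp del: fun_upd_apply)
  have "?s2(Tmp (k + 1) := 0, Tmp k := ?s2 (Tmp k) - ?s2 (Tmp (k + 1))) = s(Tmp k := ?a - ?b)"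
    using Minus.prems(2)[of "k + 1"] by (auto simp: fun_eq_iff)
  then have 3: "big N I (subtract (Tmp (k + 1)) (Tmp k)) (?s2, hs, out) (s(Tmp k := ?a - ?b), hs, out)"
    using big_subtract[of "Tmp (k + 1)" "Tmp k" N I ?s2 hs out] by simp
  show ?case using big.Seq[OF 1 big.Seq[OF 2 3]] by (simp del: fun_upd_apply)
next
  case (Times e f)
  let ?a = "eval e (env_of s)" and ?b = "eval f (env_of s)"
  let ?s1 = "s(Tmp k := ?a)"
  let ?s2 = "?s1(Tmp (k + 1) := ?b)"
  have 1: "big N I (evaluate k e) (s, hs, out) (?s1, hs, out)"
    by (rule Times.IH(1)) (use Times.prems in auto)
  have "?s1 (Tmp j) = 0" if "k + 1 \<le> j" for j
    using Times.prems(2)[of j] that by simp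
  then have 2: "big N I (evaluate (k + 1) f) (?s1, hs, out) (?s2, hs, out)"
    using Times.IH(2)[of ?s1 "k + 1"] Times.prems(1) by (simp del: fun_upd_apply)
  let ?loop = "While (Pos (Tmp k)) (Dec (Tmp k) ;; copy (Tmp (k + 1)) (Tmp (k + 2)) (Tmp (k + 3)))"
  let ?t = "\<lambda>i. ?s2(Tmp k := ?a - i, Tmp (k + 2) := i * ?b)"
  have "big N I ?loop (?t 0, hs, out) (?t ?a, hs, out)"
  proof (rule while_iterate[where S = "\<lambda>i. (?t i, hs, out)"])
    fix i assume i: "i < ?a"
    let ?u = "(?t i)(Tmp k := ?t i (Tmp k) - 1)"
    have "Suc i * ?b \<le> ?a * ?b" using i by (intro mult_le_mono1) simp
    then have bound: "?u (Tmp (k + 2)) + ?u (Tmp (k + 1)) \<le> N" using Times.prems(1) by simp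
    have D: "big N I (Dec (Tmp k)) (?t i, hs, out) (?u, hs, out)"
      using i by (intro big.Dec) auto
    have C: "big N I (copy (Tmp (k + 1)) (Tmp (k + 2)) (Tmp (k + 3))) (?u, hs, out)
        (?u(Tmp (k + 2) := ?u (Tmp (k + 2)) + ?u (Tmp (k + 1))), hs, out)"
      using Times.prems(2)[of "k + 3"] bound by (intro big_copy) simp_all
    have "?u(Tmp (k + 2) := ?u (Tmp (k + 2)) + ?u (Tmp (k + 1))) = ?t (Suc i)"
      by (auto simp: fun_eq_iff)
    with big.Seq[OF D C] i
    show "holds I (Pos (Tmp k)) (?t i, hs, out) \<and>
        big N I (Dec (Tmp k) ;; copy (Tmp (k + 1)) (Tmp (k + 2)) (Tmp (k + 3))) (?t i, hs, out) (?t (Suc i), hs, out)"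
      by simp
  qed simp
  moreover have "?t 0 = ?s2" using Times.prems(2)[of "k + 2"] by (auto simp: fun_eq_iff)
  ultimately have 3: "big N I ?loop (?s2, hs, out) (?t ?a, hs, out)" by metis
  let ?v = "(?t ?a)(Tmp (k + 1) := 0)"
  have 4: "big N I (clear (Tmp (k + 1))) (?t ?a, hs, out) (?v, hs, out)"
    by (rule big_clear)
  have "?v(Tmp (k + 2) := 0, Tmp k := ?v (Tmp k) + ?v (Tmp (k + 2))) = s(Tmp k := ?a * ?b)"
    using Times.prems(2)[of "k + 1"] Times.prems(2)[of "k + 2"] by (auto simp: fun_eq_iff)
  then have 5: "big N I (transfer (Tmp (k + 2)) (Tmp k)) (?v, hs, out) (s(Tmp k := ?a * ?b), hs, out)"
    using big_transfer[of "Tmp (k + 2)" "Tmp k" ?v N I hs out] Times.prems by simp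
  show ?case using big.Seq[OF 1 big.Seq[OF 2 big.Seq[OF 3 big.Seq[OF 4 5]]]] by (simp del: fun_upd_apply)
qed

text \<open>Between assignments the evaluation stack is empty, so the named variables determine the
  whole store.\<close>

fun lift :: "(name \<Rightarrow> nat) \<Rightarrow> reg \<Rightarrow> nat" where
  "lift \<rho> (Var x) = \<rho> x"
| "lift \<rho> (Tmp k) = 0"

lemma env_of_lift [simp]: "env_of (lift \<rho>) = \<rho>"
  by (auto simp: env_of_def)

lemma big_assign:
  assumes "fits N e \<rho>"
  shows "big N I (assign x e) (lift \<rho>, hs, out) (lift (\<rho>(x := eval e \<rho>)), hs, out)"
proof -
  let ?s = "(lift \<rho>)(Tmp 0 := eval e \<rho>)"
  let ?t = "?s(Var x := 0)"
  have 1: "big N I (evaluate 0 e) (lift \<rho>, hs, out) (?s, hs, out)"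
    using big_evaluate[of N e "lift \<rho>" 0] assms by simp
  have 2: "big N I (clear (Var x)) (?s, hs, out) (?t, hs, out)" by (rule big_clear)
  have "(?t(Tmp 0 := 0, Var x := ?t (Var x) + ?t (Tmp 0))) r = lift (\<rho>(x := eval e \<rho>)) r" for r
    by (cases r) auto
  then have eq: "?t(Tmp 0 := 0, Var x := ?t (Var x) + ?t (Tmp 0)) = lift (\<rho>(x := eval e \<rho>))"
    by blast
  have 3: "big N I (transfer (Tmp 0) (Var x)) (?t, hs, out) (lift (\<rho>(x := eval e \<rho>)), hs, out)"
    using big_transfer[of "Tmp 0" "Var x" ?t N I hs out] fits_le[OF assms] unfolding eq by simp
  show ?thesis unfolding assign_def by (rule big.Seq[OF 1 big.Seq[OF 2 3]])
qed

section \<open>The program\<close>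

fun vars :: "expr \<Rightarrow> name set" where
  "vars (V x) = {x}"
| "vars (Num n) = {}"
| "vars (Plus e f) = vars e \<union> vars f"
| "vars (Minus e f) = vars e \<union> vars f"
| "vars (Times e f) = vars e \<union> vars f"

text \<open>A degree: if \<open>Y \<ge> 2\<close> bounds the variables, \<open>Y ^ weight e\<close>
  bounds every intermediate value. Sums may add degrees like products do, since
  \<open>a + b \<le> a * b\<close> for numbers from 2 on, and a literal \<open>n\<close> is paid for
  by \<open>n \<le> 2 ^ Suc n\<close>.\<close>

fun weight :: "expr \<Rightarrow> nat" where
  "weight (V x) = 1"
| "weight (Num n) = Suc n"
| "weight (Plus e f) = weight e + weight f"
| "weight (Minus e f) = weight e + weight f"
| "weight (Times e f) = weight e + weight f"

lemma weight_pos: "0 < weight e"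
  by (induction e) auto

lemma fits_weight:
  assumes "2 \<le> Y" "\<forall>x\<in>vars e. \<rho> x \<le> Y" "Y ^ weight e \<le> N"
  shows "fits N e \<rho> \<and> eval e \<rho> \<le> Y ^ weight e"
  using assms(2,3)
proof (induction e)
  case (V x)
  then show ?case by auto
next
  case (Num n)
  have "n \<le> 2 ^ Suc n" using less_exp[of "Suc n"] by linarith
  also have "\<dots> \<le> Y ^ Suc n" using assms(1) by (intro power_mono) auto
  finally have "n \<le> Y ^ weight (Num n)" by simp
  then show ?case using Num.prems(2) by (auto simp del: weight.simps)
next
  case (Plus e f)
  let ?a = "Y ^ weight e" and ?b = "Y ^ weight f"
  have big: "2 \<le> Y ^ weight e" for e
    using assms(1) self_le_power[of Y "weight e"] weight_pos[of e] by linarith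
  have "?a \<le> Y ^ (weight e + weight f)" "?b \<le> Y ^ (weight e + weight f)"
    using assms(1) by (intro power_increasing; simp)+
  then have IH: "fits N e \<rho>" "eval e \<rho> \<le> ?a" "fits N f \<rho>" "eval f \<rho> \<le> ?b"
    using Plus by auto
  obtain a b where "?a = a + 2" "?b = b + 2" using big by (metis add.commute le_Suc_ex)
  then have "?a + ?b \<le> ?a * ?b" by (simp add: algebra_simps)
  then have "eval e \<rho> + eval f \<rho> \<le> Y ^ (weight e + weight f)" using IH by (simp add: power_add)
  then show ?case using IH Plus.prems by simp
next
  case (Minus e f)
  have le: "Y ^ weight e \<le> Y ^ (weight e + weight f)" "Y ^ weight f \<le> Y ^ (weight e + weight f)"
    using assms(1) by (intro power_increasing; simp)+
  then have "fits N e \<rho>" "eval e \<rho> \<le> Y ^ weight e" "fits N f \<rho>"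
    using Minus by auto
  then show ?case using le by simp
next
  case (Times e f)
  have "Y ^ weight e \<le> Y ^ (weight e + weight f)" "Y ^ weight f \<le> Y ^ (weight e + weight f)"
    using assms(1) by (intro power_increasing; simp)+
  then have IH: "fits N e \<rho>" "eval e \<rho> \<le> Y ^ weight e" "fits N f \<rho>" "eval f \<rho> \<le> Y ^ weight f"
    using Times by auto
  then have "eval e \<rho> * eval f \<rho> \<le> Y ^ (weight e + weight f)" by (simp add: power_add mult_le_mono)
  then show ?case using IH Times.prems by simp
qed

definition env :: "walk \<Rightarrow> nat \<Rightarrow> nat \<Rightarrow> nat \<Rightarrow> bool \<Rightarrow> nat \<Rightarrow> name \<Rightarrow> nat" where
  "env s c d m b f x = (case s of (A, Z, H, W, K) \<Rightarrow>
     (case x of First \<Rightarrow> A | Second \<Rightarrow> Z | Scale \<Rightarrow> H | Cut \<Rightarrow> W | Cut_Scale \<Rightarrow> K |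
        Numer \<Rightarrow> c | Denom \<Rightarrow> d | Todo \<Rightarrow> m | Parity \<Rightarrow> of_bool b | Flag \<Rightarrow> f))"

lemma env_apply [simp]:
  "env (A, Z, H, W, K) c d m b f First = A" "env (A, Z, H, W, K) c d m b f Second = Z"
  "env (A, Z, H, W, K) c d m b f Scale = H" "env (A, Z, H, W, K) c d m b f Cut = W"
  "env (A, Z, H, W, K) c d m b f Cut_Scale = K" "env s c d m b f Numer = c"
  "env s c d m b f Denom = d" "env s c d m b f Todo = m"
  "env s c d m b f Parity = of_bool b" "env s c d m b f Flag = f"
  by (auto simp: env_def split: prod.splits)

lemma env_update:
  "(env (A, Z, H, W, K) c d m b f)(First := v) = env (v, Z, H, W, K) c d m b f"
  "(env (A, Z, H, W, K) c d m b f)(Second := v) = env (A, v, H, W, K) c d m b f"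
  "(env (A, Z, H, W, K) c d m b f)(Scale := v) = env (A, Z, v, W, K) c d m b f"
  "(env (A, Z, H, W, K) c d m b f)(Cut := v) = env (A, Z, H, v, K) c d m b f"
  "(env (A, Z, H, W, K) c d m b f)(Cut_Scale := v) = env (A, Z, H, W, v) c d m b f"
  "(env s c d m b f)(Numer := v) = env s v d m b f"
  "(env s c d m b f)(Denom := v) = env s c v m b f"
  "(env s c d m b f)(Todo := v) = env s c d v b f"
  "(env s c d m b f)(Parity := of_bool t) = env s c d m t f"
  "(env s c d m b f)(Flag := v) = env s c d m b v"
  by (rule ext; simp add: env_def split: name.split prod.split)+

text \<open>The exponent 10 covers all expressions of the program; the heaviest are the length tests
  in \<open>select\<close>, of weight 9.\<close>

lemma assign_env:
  assumes "2 \<le> Y" "Y ^ 10 \<le> N" "weight e \<le> 10" "\<forall>x\<in>vars e. \<rho> x \<le> Y" "\<rho>(x := eval e \<rho>) = \<rho>'"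
  shows "big N I (assign x e) (lift \<rho>, hs, out) (lift \<rho>', hs, out)"
proof -
  have "Y ^ weight e \<le> Y ^ 10" using assms by (intro power_increasing) auto
  then have "fits N e \<rho>" using fits_weight[of Y e \<rho> N] assms by linarith
  from big_assign[OF this] show ?thesis using assms(5) by metis
qed

section \<open>The program for one step of the walk\<close>

abbreviation folded :: "name \<Rightarrow> expr" where
  "folded x \<equiv> Minus (V x) (Times (Num 2) (Minus (V x) (V Scale)))"

text \<open>\<open>Parity\<close> holds the last bit emitted, and a positive \<open>Flag\<close>
  means that the walk is right of 1/2.\<close>

definition emit_side :: "reg com" where
  "emit_side =
     IfElse (Pos (Var Flag)) (assign Parity (Minus (Num 1) (V Parity))) Skip ;;
     IfElse (Pos (Var Parity)) (Emit True) (Emit False)"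

definition glide :: "reg com" where
  "glide =
     assign Flag (Minus (Plus (V First) (V Second)) (Times (Num 2) (V Scale))) ;; emit_side ;;
     assign First (Times (V Numer) (folded First)) ;;
     assign Second (Times (V Numer) (folded Second)) ;;
     assign Scale (Times (V Denom) (V Scale))"

definition select :: "reg com" where
  "select =
     assign Flag (Minus (Times (folded Second) (V Cut_Scale)) (Times (V Cut) (V Scale))) ;;
     IfElse (Pos (Var Flag))
       (assign Flag (Minus (V First) (V Scale)) ;; emit_side ;;
        assign Flag (Minus (Times (folded First) (V Cut_Scale)) (Times (V Cut) (V Scale))) ;;
        IfElse (Pos (Var Flag)) (assign Cut (folded First) ;; assign Cut_Scale (V Scale)) Skip)
       (assign Flag (Minus (V Second) (V Scale)) ;; emit_side) ;;
     assign First (Times (V Numer) (V Cut_Scale)) ;;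
     assign Second (Times (V Numer) (V Cut)) ;;
     assign Scale (Times (V Denom) (V Cut_Scale))"

text \<open>Truncated differences turn strict order into positivity: the first value of
  \<open>Flag\<close> is positive exactly if \<open>crosses\<close> holds. \<open>Flag\<close> is
  cleared at the end so that the store has the same form after every round.\<close>

definition one_round :: "reg com" where
  "one_round =
     assign Flag (Plus (Times (Minus (V Scale) (V First)) (Minus (V Second) (V Scale)))
                       (Times (Minus (V First) (V Scale)) (Minus (V Scale) (V Second)))) ;;
     IfElse (Pos (Var Flag)) select glide ;;
     assign Todo (Minus (V Todo) (Num 1)) ;;
     assign Flag (Num 0)"

lemma big_emit_side:
  assumes "2 \<le> Y" "Y ^ 10 \<le> N"
  shows "big N I emit_side (lift (env s c d m b f), hs, out)
    (lift (env s c d m (b \<noteq> (0 < f)) f), hs, out @ [b \<noteq> (0 < f)])"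
proof -
  let ?b = "b \<noteq> (0 < f)"
  have 1: "big N I (IfElse (Pos (Var Flag)) (assign Parity (Minus (Num 1) (V Parity))) Skip)
      (lift (env s c d m b f), hs, out) (lift (env s c d m ?b f), hs, out)"
  proof (cases "0 < f")
    case True
    have "1 - of_bool b = (of_bool (b \<noteq> (0 < f)) :: nat)" using True by simp
    then have eq: "(env s c d m b f)(Parity := eval (Minus (Num 1) (V Parity)) (env s c d m b f)) = env s c d m ?b f"
      by (simp only: eval.simps env_apply env_update)
    have "big N I (assign Parity (Minus (Num 1) (V Parity)))
        (lift (env s c d m b f), hs, out) (lift (env s c d m ?b f), hs, out)"
      by (rule assign_env[OF assms _ _ eq]) (use assms(1) in simp_all)
    then show ?thesis using True by (intro big.IfTrue) auto
  next
    case False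
    then show ?thesis by (auto intro: big.IfFalse big.Skip)
  qed
  have 2: "big N I (IfElse (Pos (Var Parity)) (Emit True) (Emit False))
      (lift (env s c d m t f), hs, out) (lift (env s c d m t f), hs, out @ [t])" for t
    by (cases t) (auto intro: big.IfTrue big.IfFalse big.Emit)
  show ?thesis unfolding emit_side_def by (rule big.Seq[OF 1 2])
qed

fun walk_le :: "nat \<Rightarrow> walk \<Rightarrow> bool" where
  "walk_le Y (A, Z, H, W, K) \<longleftrightarrow> A \<le> Y \<and> Z \<le> Y \<and> H \<le> Y \<and> W \<le> Y \<and> K \<le> Y"

lemma big_glide:
  assumes Y: "2 \<le> Y" "Y ^ 10 \<le> N"
    and le: "walk_le Y (A, Z, H, W, K)" "c \<le> Y" "d \<le> Y" and ncross: "\<not> crosses A Z H"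
  shows "\<exists>f. big N I glide (lift (env (A, Z, H, W, K) c d m b f0), hs, out)
    (lift (env (advance c d (A, Z, H, W, K)) c d m (b \<noteq> side (A, Z, H, W, K)) f), hs,
      out @ [b \<noteq> side (A, Z, H, W, K)])"
proof -
  let ?b = "b \<noteq> side (A, Z, H, W, K)"
  let ?f = "A + Z - 2 * H"
  have side: "side (A, Z, H, W, K) \<longleftrightarrow> 0 < ?f" using ncross by auto
  let ?A = "c * fold_over H A" and ?Z = "c * fold_over H Z"
  have 1: "big N I (assign Flag (Minus (Plus (V First) (V Second)) (Times (Num 2) (V Scale))))
      (lift (env (A, Z, H, W, K) c d m b f0), hs, out) (lift (env (A, Z, H, W, K) c d m b ?f), hs, out)"
    using le by (intro assign_env[OF Y]) (auto simp: env_update)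
  have 2: "big N I emit_side (lift (env (A, Z, H, W, K) c d m b ?f), hs, out)
      (lift (env (A, Z, H, W, K) c d m ?b ?f), hs, out @ [?b])"
    using big_emit_side[OF Y] unfolding side by blast
  have 3: "big N I (assign First (Times (V Numer) (folded First)))
      (lift (env (A, Z, H, W, K) c d m ?b ?f), hs, out @ [?b])
      (lift (env (?A, Z, H, W, K) c d m ?b ?f), hs, out @ [?b])"
    using le by (intro assign_env[OF Y]) (auto simp: env_update fold_over_def)
  have 4: "big N I (assign Second (Times (V Numer) (folded Second)))
      (lift (env (?A, Z, H, W, K) c d m ?b ?f), hs, out @ [?b])
      (lift (env (?A, ?Z, H, W, K) c d m ?b ?f), hs, out @ [?b])"
    using le by (intro assign_env[OF Y]) (auto simp: env_update fold_over_def)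
  have 5: "big N I (assign Scale (Times (V Denom) (V Scale)))
      (lift (env (?A, ?Z, H, W, K) c d m ?b ?f), hs, out @ [?b])
      (lift (env (?A, ?Z, d * H, W, K) c d m ?b ?f), hs, out @ [?b])"
    using le by (intro assign_env[OF Y]) (auto simp: env_update)
  have "advance c d (A, Z, H, W, K) = (?A, ?Z, d * H, W, K)" using ncross by simp
  then show ?thesis
    unfolding glide_def
    using big.Seq[OF 1 big.Seq[OF 2 big.Seq[OF 3 big.Seq[OF 4 5]]]] by metis
qed

lemma big_select:
  assumes Y: "2 \<le> Y" "Y ^ 10 \<le> N"
    and le: "walk_le Y (A, Z, H, W, K)" "c \<le> Y" "d \<le> Y" and cross: "crosses A Z H"
  shows "\<exists>f. big N I select (lift (env (A, Z, H, W, K) c d m b f0), hs, out)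
    (lift (env (advance c d (A, Z, H, W, K)) c d m (b \<noteq> side (A, Z, H, W, K)) f), hs,
      out @ [b \<noteq> side (A, Z, H, W, K)])"
proof -
  let ?s = "(A, Z, H, W, K)"
  let ?b = "b \<noteq> side ?s"
  let ?far = "IfElse (Pos (Var Flag))
       (assign Flag (Minus (V First) (V Scale)) ;; emit_side ;;
        assign Flag (Minus (Times (folded First) (V Cut_Scale)) (Times (V Cut) (V Scale))) ;;
        IfElse (Pos (Var Flag)) (assign Cut (folded First) ;; assign Cut_Scale (V Scale)) Skip)
       (assign Flag (Minus (V Second) (V Scale)) ;; emit_side)"
  obtain W' K' where cut: "next_cut ?s = (W', K')" by fastforce
  let ?f = "fold_over H Z * K - W * H"
  have fold_le: "fold_over H A \<le> Y" using le by (auto simp: fold_over_def)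
  have cut_le: "W' \<le> Y" "K' \<le> Y" using cut le fold_le by (auto split: if_splits)
  have 1: "big N I (assign Flag (Minus (Times (folded Second) (V Cut_Scale)) (Times (V Cut) (V Scale))))
      (lift (env ?s c d m b f0), hs, out) (lift (env ?s c d m b ?f), hs, out)"
    using le by (intro assign_env[OF Y]) (auto simp: env_update fold_over_def)
  have "\<exists>f. big N I ?far (lift (env ?s c d m b ?f), hs, out)
      (lift (env (A, Z, H, W', K') c d m ?b f), hs, out @ [?b])"
  proof (cases "0 < ?f")
    case True
    let ?g = "fold_over H A * K - W * H"
    have side: "side ?s \<longleftrightarrow> 0 < A - H" using cross True by auto
    have a: "big N I (assign Flag (Minus (V First) (V Scale)))
        (lift (env ?s c d m b ?f), hs, out) (lift (env ?s c d m b (A - H)), hs, out)"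
      using le by (intro assign_env[OF Y]) (auto simp: env_update)
    have b: "big N I emit_side (lift (env ?s c d m b (A - H)), hs, out)
        (lift (env ?s c d m ?b (A - H)), hs, out @ [?b])"
      using big_emit_side[OF Y] unfolding side by blast
    have c: "big N I (assign Flag (Minus (Times (folded First) (V Cut_Scale)) (Times (V Cut) (V Scale))))
        (lift (env ?s c d m ?b (A - H)), hs, out @ [?b]) (lift (env ?s c d m ?b ?g), hs, out @ [?b])"
      using le by (intro assign_env[OF Y]) (auto simp: env_update fold_over_def)
    have d: "big N I (IfElse (Pos (Var Flag)) (assign Cut (folded First) ;; assign Cut_Scale (V Scale)) Skip)
        (lift (env ?s c d m ?b ?g), hs, out @ [?b]) (lift (env (A, Z, H, W', K') c d m ?b ?g), hs, out @ [?b])"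
    proof (cases "0 < ?g")
      case T: True
      then have W': "W' = fold_over H A" "K' = H" using True cut by auto
      have e: "big N I (assign Cut (folded First)) (lift (env ?s c d m ?b ?g), hs, out @ [?b])
          (lift (env (A, Z, H, W', K) c d m ?b ?g), hs, out @ [?b])"
        using le by (intro assign_env[OF Y]) (auto simp: env_update fold_over_def W')
      have f: "big N I (assign Cut_Scale (V Scale)) (lift (env (A, Z, H, W', K) c d m ?b ?g), hs, out @ [?b])
          (lift (env (A, Z, H, W', K') c d m ?b ?g), hs, out @ [?b])"
        using le by (intro assign_env[OF Y]) (auto simp: env_update W')
      show ?thesis using T by (intro big.IfTrue big.Seq[OF e f]) auto
    next
      case F: False
      then have "W' = W" "K' = K" using cut by (auto split: if_splits)
      then show ?thesis using F by (auto intro!: big.IfFalse big.Skip)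
    qed
    have "big N I ?far (lift (env ?s c d m b ?f), hs, out)
        (lift (env (A, Z, H, W', K') c d m ?b ?g), hs, out @ [?b])"
      using True by (intro big.IfTrue big.Seq[OF a big.Seq[OF b big.Seq[OF c d]]]) auto
    then show ?thesis by blast
  next
    case False
    have W': "W' = W" "K' = K" using cut False by (auto split: if_splits)
    have side: "side ?s \<longleftrightarrow> 0 < Z - H" using cross False by auto
    have a: "big N I (assign Flag (Minus (V Second) (V Scale)))
        (lift (env ?s c d m b ?f), hs, out) (lift (env ?s c d m b (Z - H)), hs, out)"
      using le by (intro assign_env[OF Y]) (auto simp: env_update)
    have b: "big N I emit_side (lift (env ?s c d m b (Z - H)), hs, out)
        (lift (env ?s c d m ?b (Z - H)), hs, out @ [?b])"
      using big_emit_side[OF Y] unfolding side by blast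
    have "big N I ?far (lift (env ?s c d m b ?f), hs, out)
        (lift (env ?s c d m ?b (Z - H)), hs, out @ [?b])"
      using False by (intro big.IfFalse big.Seq[OF a b]) auto
    then show ?thesis unfolding W' by blast
  qed
  then obtain f where 2: "big N I ?far (lift (env ?s c d m b ?f), hs, out)
      (lift (env (A, Z, H, W', K') c d m ?b f), hs, out @ [?b])" by blast
  have 3: "big N I (assign First (Times (V Numer) (V Cut_Scale)))
      (lift (env (A, Z, H, W', K') c d m ?b f), hs, out @ [?b])
      (lift (env (c * K', Z, H, W', K') c d m ?b f), hs, out @ [?b])"
    using le cut_le by (intro assign_env[OF Y]) (auto simp: env_update)
  have 4: "big N I (assign Second (Times (V Numer) (V Cut)))
      (lift (env (c * K', Z, H, W', K') c d m ?b f), hs, out @ [?b])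
      (lift (env (c * K', c * W', H, W', K') c d m ?b f), hs, out @ [?b])"
    using le cut_le by (intro assign_env[OF Y]) (auto simp: env_update)
  have 5: "big N I (assign Scale (Times (V Denom) (V Cut_Scale)))
      (lift (env (c * K', c * W', H, W', K') c d m ?b f), hs, out @ [?b])
      (lift (env (c * K', c * W', d * K', W', K') c d m ?b f), hs, out @ [?b])"
    using le cut_le by (intro assign_env[OF Y]) (auto simp: env_update)
  have "advance c d ?s = (c * K', c * W', d * K', W', K')" using cross cut by simp
  then show ?thesis
    unfolding select_def
    using big.Seq[OF 1 big.Seq[OF 2 big.Seq[OF 3 big.Seq[OF 4 5]]]] by metis
qed

lemma big_one_round:
  assumes Y: "2 \<le> Y" "Y ^ 10 \<le> N"
    and le: "walk_le Y s" "c \<le> Y" "d \<le> Y" "m \<le> Y"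
  shows "big N I one_round (lift (env s c d m b 0), hs, out)
    (lift (env (advance c d s) c d (m - 1) (b \<noteq> side s) 0), hs, out @ [b \<noteq> side s])"
proof -
  obtain A Z H W K where s: "s = (A, Z, H, W, K)" by (metis prod_cases5)
  let ?f = "(H - A) * (Z - H) + (A - H) * (H - Z)"
  let ?e = "Plus (Times (Minus (V Scale) (V First)) (Minus (V Second) (V Scale)))
                       (Times (Minus (V First) (V Scale)) (Minus (V Scale) (V Second)))"
  have f: "0 < ?f \<longleftrightarrow> crosses A Z H" by (auto simp: crosses_def)
  have 1: "big N I (assign Flag ?e) (lift (env s c d m b 0), hs, out) (lift (env s c d m b ?f), hs, out)"
    unfolding s using le by (intro assign_env[OF Y]) (auto simp: env_update s)
  have "\<exists>g. big N I (IfElse (Pos (Var Flag)) select glide) (lift (env s c d m b ?f), hs, out)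
      (lift (env (advance c d s) c d m (b \<noteq> side s) g), hs, out @ [b \<noteq> side s])"
  proof (cases "crosses A Z H")
    case True
    then show ?thesis using big_select[OF Y, of A Z H W K c d I m b ?f hs out] f le
      unfolding s by (metis big.IfTrue holds.simps(1) lift.simps(1) env_apply(10))
  next
    case False
    then show ?thesis using big_glide[OF Y, of A Z H W K c d I m b ?f hs out] f le
      unfolding s by (metis big.IfFalse holds.simps(1) lift.simps(1) env_apply(10))
  qed
  then obtain g where 2: "big N I (IfElse (Pos (Var Flag)) select glide) (lift (env s c d m b ?f), hs, out)
      (lift (env (advance c d s) c d m (b \<noteq> side s) g), hs, out @ [b \<noteq> side s])" by blast
  have 3: "big N I (assign Todo (Minus (V Todo) (Num 1)))
      (lift (env (advance c d s) c d m (b \<noteq> side s) g), hs, out @ [b \<noteq> side s])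
      (lift (env (advance c d s) c d (m - 1) (b \<noteq> side s) g), hs, out @ [b \<noteq> side s])"
    using le by (intro assign_env[OF Y]) (auto simp: env_update)
  have 4: "big N I (assign Flag (Num 0))
      (lift (env (advance c d s) c d (m - 1) (b \<noteq> side s) g), hs, out @ [b \<noteq> side s])
      (lift (env (advance c d s) c d (m - 1) (b \<noteq> side s) 0), hs, out @ [b \<noteq> side s])"
    by (intro assign_env[OF Y]) (auto simp: env_update)
  show ?thesis unfolding one_round_def by (rule big.Seq[OF 1 big.Seq[OF 2 big.Seq[OF 3 4]]])
qed

primrec code :: "nat \<Rightarrow> nat \<Rightarrow> walk \<Rightarrow> nat \<Rightarrow> bool list" where
  "code c d s 0 = []"
| "code c d s (Suc t) = code c d s t @ [lastbit (code c d s t) \<noteq> side ((advance c d ^^ t) s)]"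

lemma big_rounds:
  assumes Y: "2 \<le> Y" "Y ^ 10 \<le> N"
    and le: "\<And>t. walk_le Y ((advance c d ^^ t) s)" "c \<le> Y" "d \<le> Y" "n \<le> Y"
  shows "\<exists>r. big N I (While (Pos (Var Todo)) one_round) (lift (env s c d n False 0), hs, []) (r, hs, code c d s n)"
proof -
  let ?S = "\<lambda>t. (lift (env ((advance c d ^^ t) s) c d (n - t) (lastbit (code c d s t)) 0), hs, code c d s t)"
  have "big N I (While (Pos (Var Todo)) one_round) (?S 0) (?S n)"
  proof (rule while_iterate)
    fix t assume t: "t < n"
    have "big N I one_round (?S t) (?S (Suc t))"
      using big_one_round[OF Y le(1)[of t] le(2,3), of "n - t" I "lastbit (code c d s t)" hs "code c d s t"] le t
      by (simp add: lastbit_def)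
    then show "holds I (Pos (Var Todo)) (?S t) \<and> big N I one_round (?S t) (?S (Suc t))"
      using t by simp
  qed simp
  then show ?thesis by (auto simp: lastbit_def)
qed

section \<open>Reading the inputs\<close>

primrec prefix :: "(nat \<Rightarrow> bool) \<Rightarrow> nat \<Rightarrow> nat" where
  "prefix b 0 = 0"
| "prefix b (Suc i) = 2 * prefix b i + of_bool (b i)"

definition read_number :: "port \<Rightarrow> name \<Rightarrow> reg com" where
  "read_number p x = Shift p GoRight ;;
     While (Sees p {Bit False, Bit True})
       (assign x (Plus (V x) (V x)) ;;
        IfElse (Sees p {Bit True}) (Inc (Var x)) Skip ;;
        Shift p GoRight)"

lemma prefix_mono: "i \<le> j \<Longrightarrow> prefix b i \<le> prefix b j"
  by (rule lift_Suc_mono_le) auto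

lemma prefix_cong: "(\<And>j. j < i \<Longrightarrow> b j = b' j) \<Longrightarrow> prefix b i = prefix b' i"
  by (induction i) auto

lemma prefix_less: "prefix b i < 2 ^ i"
  by (induction i) (auto simp: of_bool_def)

lemma prefix_binary_word: "prefix (\<lambda>i. binary_word n ! i) (length (binary_word n)) = n"
proof (induction n rule: binary_word.induct)
  case (1 n)
  show ?case
  proof (cases "n = 0")
    case True
    then show ?thesis by (simp add: binary_word.simps)
  next
    case False
    let ?w = "binary_word (n div 2)"
    have w: "binary_word n = ?w @ [odd n]" using False by (subst binary_word.simps) simp
    have "prefix (\<lambda>i. (?w @ [odd n]) ! i) (length ?w) = prefix (\<lambda>i. ?w ! i) (length ?w)"
      by (intro prefix_cong) (simp add: nth_append)
    then show ?thesis using 1[OF False] by (simp add: w)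
  qed
qed

text \<open>Crude, but it keeps the input heads below the bound that the registers obey
  anyway.\<close>

lemma length_binary_word: "length (binary_word n) \<le> n"
proof (induction n rule: binary_word.induct)
  case (1 n)
  then show ?case
    by (cases "n = 0") (subst binary_word.simps, force)+
qed

lemma big_read_number:
  assumes I: "I p = word_tape (binary_word n)" and "hs p = 0" and le: "2 \<le> Y" "Y ^ 10 \<le> N" "n < Y" "\<rho> x = 0"
  shows "\<exists>h. big N I (read_number p x) (lift \<rho>, hs, out) (lift (\<rho>(x := n)), hs(p := h), out)"
proof -
  let ?w = "binary_word n"
  let ?v = "\<lambda>i. prefix (\<lambda>i. ?w ! i) i"
  let ?S = "\<lambda>i. (lift (\<rho>(x := ?v i)), hs(p := Suc i), out)"
  have NY: "Y \<le> N" using le self_le_power[of Y 10] by simp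
  have len: "length ?w \<le> n" by (rule length_binary_word)
  have "big N I (While (Sees p {Bit False, Bit True})
       (assign x (Plus (V x) (V x)) ;; IfElse (Sees p {Bit True}) (Inc (Var x)) Skip ;; Shift p GoRight)) (?S 0) (?S (length ?w))"
  proof (rule while_iterate)
    fix i assume i: "i < length ?w"
    have mono: "?v (Suc i) \<le> n" using prefix_mono[of "Suc i" "length ?w" "\<lambda>i. ?w ! i"] i prefix_binary_word[of n] by simp
    have sees: "I p (Suc i) = Bit (?w ! i)" using i by (simp add: I word_tape_def)
    let ?\<rho> = "\<rho>(x := 2 * ?v i)"
    have 1: "big N I (assign x (Plus (V x) (V x))) (?S i) (lift ?\<rho>, hs(p := Suc i), out)"
      using le mono by (intro assign_env[OF le(1,2)]) auto
    have 2: "big N I (IfElse (Sees p {Bit True}) (Inc (Var x)) Skip) (lift ?\<rho>, hs(p := Suc i), out)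
       (lift (\<rho>(x := ?v (Suc i))), hs(p := Suc i), out)"
    proof (cases "?w ! i")
      case True
      have "((lift ?\<rho>)(Var x := Suc (lift ?\<rho> (Var x)))) r = lift (\<rho>(x := ?v (Suc i))) r" for r
        using True by (cases r) auto
      then have eq: "(lift ?\<rho>)(Var x := Suc (lift ?\<rho> (Var x))) = lift (\<rho>(x := ?v (Suc i)))" by blast
      have "big N I (Inc (Var x)) (lift ?\<rho>, hs(p := Suc i), out)
          ((lift ?\<rho>)(Var x := Suc (lift ?\<rho> (Var x))), hs(p := Suc i), out)"
        using mono True NY le by (intro big.Inc) auto
      then show ?thesis using True sees unfolding eq by (intro big.IfTrue) auto
    next
      case False
      then show ?thesis using sees by (auto intro!: big.IfFalse big.Skip simp del: fun_upd_apply simp: fun_upd_same)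
    qed
    have 3: "big N I (Shift p GoRight) (lift (\<rho>(x := ?v (Suc i))), hs(p := Suc i), out) (?S (Suc i))"
      using big.Shift[of GoRight "hs(p := Suc i)" p N I "lift (\<rho>(x := ?v (Suc i)))" out] i len NY le by simp
    show "holds I (Sees p {Bit False, Bit True}) (?S i) \<and> big N I
       (assign x (Plus (V x) (V x)) ;; IfElse (Sees p {Bit True}) (Inc (Var x)) Skip ;; Shift p GoRight) (?S i) (?S (Suc i))"
      using big.Seq[OF 1 big.Seq[OF 2 3]] sees by (auto simp del: fun_upd_apply simp add: fun_upd_same)
  qed (simp add: I word_tape_def)
  moreover have "big N I (Shift p GoRight) (lift \<rho>, hs, out) (?S 0)"
    using big.Shift[of GoRight hs p N I "lift \<rho>" out] assms NY by (simp add: fun_upd_idem)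
  ultimately show ?thesis
    unfolding read_number_def using prefix_binary_word[of n] by (metis big.Seq)
qed

text \<open>The \<open>Accuracy\<close> head starts on the end marker, so a leading one at index
  \<open>j\<close> lets the loop read \<open>Suc j\<close> bits of the point, enough for
  \<open>1 / 2 ^ Suc j \<le> \<epsilon>\<close>. \<open>First\<close> and \<open>Second\<close> are
  doubled because \<open>ratio\<close> divides by twice the scale. \<open>Cut\<close> is set to give
  the half-width \<open>1 / 2 ^ (q + 1)\<close>, half the length of the interval, where
  \<open>q = Suc j\<close>.\<close>

definition read_point :: "reg com" where
  "read_point =
     assign Scale (Num 1) ;;
     Shift Initial_Point GoRight ;;
     While (Sees Accuracy (- {Bit True}))
       (assign First (Plus (V First) (V First)) ;;
        IfElse (Sees Initial_Point {Bit True}) (assign First (Plus (V First) (Num 2))) Skip ;;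
        assign Scale (Plus (V Scale) (V Scale)) ;;
        Shift Initial_Point GoRight ;;
        Shift Accuracy GoRight) ;;
     assign Second (Plus (V First) (Num 2)) ;;
     assign Cut (Minus (V Scale) (Num 1)) ;;
     assign Cut_Scale (V Scale)"

lemma big_read_point:
  assumes I: "I Accuracy = stream_tape eb" "I Initial_Point = stream_tape xb"
    and hs: "hs Accuracy = 0" "hs Initial_Point = 0"
    and q: "\<And>i. i < j \<Longrightarrow> \<not> eb i" "eb j" and le: "2 \<le> Y" "Y ^ 10 \<le> N" "2 * 2 ^ Suc j \<le> Y"
  shows "\<exists>hs'. big N I read_point (lift (env (0, 0, 0, 0, 0) c d n False 0), hs, out)
    (lift (env (2 * prefix xb (Suc j), 2 * prefix xb (Suc j) + 2, 2 ^ Suc j, 2 ^ Suc j - 1, 2 ^ Suc j) c d n False 0), hs', out)"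
proof -
  let ?q = "Suc j" and ?X = "prefix xb"
  let ?h = "\<lambda>i. hs(Initial_Point := Suc i, Accuracy := i)"
  let ?e = "\<lambda>A H. lift (env (A, 0, H, 0, 0) c d n False 0)"
  let ?S = "\<lambda>i. (?e (2 * ?X i) (2 ^ i), ?h i, out)"
  have NY: "Y \<le> N" using le self_le_power[of Y 10] by simp
  let ?body = "assign First (Plus (V First) (V First)) ;;
        IfElse (Sees Initial_Point {Bit True}) (assign First (Plus (V First) (Num 2))) Skip ;;
        assign Scale (Plus (V Scale) (V Scale)) ;;
        Shift Initial_Point GoRight ;;
        Shift Accuracy GoRight"
  have 1: "big N I (assign Scale (Num 1)) (?e 0 0, hs, out) (?e 0 1, hs, out)"
    by (intro assign_env[OF le(1,2)]) (auto simp: env_update)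
  have 2: "big N I (Shift Initial_Point GoRight) (?e 0 1, hs, out) (?S 0)"
    using big.Shift[of GoRight hs Initial_Point N I "?e 0 1" out] hs NY le(1)
    by (simp add: fun_upd_idem)
  have 3: "big N I (While (Sees Accuracy (- {Bit True})) ?body) (?S 0) (?S ?q)"
  proof (rule while_iterate)
    fix i assume i: "i < ?q"
    have "(2::nat) ^ Suc i \<le> 2 ^ ?q" using i by (intro power_increasing) auto
    then have pow: "2 * 2 ^ Suc i \<le> Y" using le(3) by linarith
    have X: "?X i < 2 ^ i" "?X (Suc i) < 2 ^ Suc i" by (rule prefix_less)+
    have ei: "Suc i \<le> 2 ^ Suc i" using less_exp[of "Suc i"] by linarith
    have a: "big N I (assign First (Plus (V First) (V First))) (?S i) (?e (4 * ?X i) (2 ^ i), ?h i, out)"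
      using X pow by (intro assign_env[OF le(1,2)]) (auto simp: env_update)
    have sees: "I Initial_Point (Suc i) = Bit (xb i)" by (simp add: I stream_tape_def)
    have b: "big N I (IfElse (Sees Initial_Point {Bit True}) (assign First (Plus (V First) (Num 2))) Skip)
        (?e (4 * ?X i) (2 ^ i), ?h i, out) (?e (2 * ?X (Suc i)) (2 ^ i), ?h i, out)"
    proof (cases "xb i")
      case True
      have "big N I (assign First (Plus (V First) (Num 2)))
        (?e (4 * ?X i) (2 ^ i), ?h i, out) (?e (2 * ?X (Suc i)) (2 ^ i), ?h i, out)"
        using X pow True by (intro assign_env[OF le(1,2)]) (auto simp: env_update)
      then show ?thesis using True sees by (intro big.IfTrue) auto
    next
      case False
      then show ?thesis using sees by (auto intro!: big.IfFalse big.Skip)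
    qed
    have c: "big N I (assign Scale (Plus (V Scale) (V Scale)))
        (?e (2 * ?X (Suc i)) (2 ^ i), ?h i, out) (?e (2 * ?X (Suc i)) (2 ^ Suc i), ?h i, out)"
      using pow by (intro assign_env[OF le(1,2)]) (auto simp: env_update mult_2)
    let ?r = "?e (2 * ?X (Suc i)) (2 ^ Suc i)"
    let ?h1 = "(?h i)(Initial_Point := Suc (Suc i))"
    have "Suc (Suc i) \<le> N" using ei pow NY by linarith
    then have d: "big N I (Shift Initial_Point GoRight) (?r, ?h i, out) (?r, ?h1, out)"
      using big.Shift[of GoRight "?h i" Initial_Point N I ?r out] by simp
    have "big N I (Shift Accuracy GoRight) (?r, ?h1, out) (?r, ?h1(Accuracy := move GoRight (?h1 Accuracy)), out)"
      using \<open>Suc (Suc i) \<le> N\<close> by (intro big.Shift) simp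
    moreover have "?h1(Accuracy := move GoRight (?h1 Accuracy)) = ?h (Suc i)" by (auto simp: fun_eq_iff)
    ultimately have e: "big N I (Shift Accuracy GoRight) (?r, ?h1, out) (?S (Suc i))" by simp
    have "I Accuracy i \<noteq> Bit True" using q(1) i by (cases i) (auto simp: I stream_tape_def)
    then show "holds I (Sees Accuracy (- {Bit True})) (?S i) \<and> big N I ?body (?S i) (?S (Suc i))"
      using big.Seq[OF a big.Seq[OF b big.Seq[OF c big.Seq[OF d e]]]] by simp
  qed (use q in \<open>simp add: I stream_tape_def\<close>)
  let ?A = "2 * ?X ?q" and ?H = "2 ^ ?q :: nat"
  have X: "?X ?q < ?H" by (rule prefix_less)
  have 4: "big N I (assign Second (Plus (V First) (Num 2))) (?S ?q)
      (lift (env (?A, ?A + 2, ?H, 0, 0) c d n False 0), ?h ?q, out)"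
    using X le(3) by (intro assign_env[OF le(1,2)]) (auto simp: env_update)
  have 5: "big N I (assign Cut (Minus (V Scale) (Num 1))) (lift (env (?A, ?A + 2, ?H, 0, 0) c d n False 0), ?h ?q, out)
      (lift (env (?A, ?A + 2, ?H, ?H - 1, 0) c d n False 0), ?h ?q, out)"
    using le(3) by (intro assign_env[OF le(1,2)]) (auto simp: env_update)
  have 6: "big N I (assign Cut_Scale (V Scale)) (lift (env (?A, ?A + 2, ?H, ?H - 1, 0) c d n False 0), ?h ?q, out)
      (lift (env (?A, ?A + 2, ?H, ?H - 1, ?H) c d n False 0), ?h ?q, out)"
    using le(3) by (intro assign_env[OF le(1,2)]) (auto simp: env_update)
  show ?thesis
    unfolding read_point_def
    using big.Seq[OF 1 big.Seq[OF 2 big.Seq[OF 3 big.Seq[OF 4 big.Seq[OF 5 6]]]]] by blast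
qed

definition tent_program :: "reg com" where
  "tent_program = read_number Numerator Numer ;; read_number Denominator Denom ;;
     read_number Code_Length Todo ;; read_point ;; While (Pos (Var Todo)) one_round"

lemma big_tent_program:
  fixes xb :: "nat \<Rightarrow> bool"
  defines "s q \<equiv> (2 * prefix xb q, 2 * prefix xb q + 2, 2 ^ q, 2 ^ q - 1, 2 ^ q)"
  assumes q: "\<And>i. i < j \<Longrightarrow> \<not> eb i" "eb j" and Y: "2 \<le> Y" "Y ^ 10 \<le> N" "2 * 2 ^ Suc j \<le> Y"
    and le: "\<And>t. walk_le Y ((advance c d ^^ t) (s (Suc j)))" "c < Y" "d < Y" "n < Y"
  shows "\<exists>r hs. big N (input_tapes c d n eb xb) tent_program (\<lambda>_. 0, \<lambda>_. 0, []) (r, hs, code c d (s (Suc j)) n)"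
proof -
  let ?I = "input_tapes c d n eb xb"
  let ?o = "(0, 0, 0, 0, 0)"
  have 0: "(\<lambda>_. 0) = lift (env ?o 0 0 0 False 0)"
  proof
    fix r show "0 = lift (env ?o 0 0 0 False 0) r"
    proof (cases r)
      case (Var x)
      then show ?thesis by (cases x) auto
    qed auto
  qed
  obtain h1 where 1: "big N ?I (read_number Numerator Numer) (lift (env ?o 0 0 0 False 0), \<lambda>_. 0, [])
      (lift (env ?o c 0 0 False 0), (\<lambda>_. 0)(Numerator := h1), [])"
    using big_read_number[of ?I Numerator c "\<lambda>_. 0" Y N "env ?o 0 0 0 False 0" Numer "[]"] Y le
    by (auto simp: env_update)
  let ?h1 = "(\<lambda>_. 0)(Numerator := h1)"
  obtain h2 where 2: "big N ?I (read_number Denominator Denom) (lift (env ?o c 0 0 False 0), ?h1, [])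
      (lift (env ?o c d 0 False 0), ?h1(Denominator := h2), [])"
    using big_read_number[of ?I Denominator d ?h1 Y N "env ?o c 0 0 False 0" Denom "[]"] Y le
    by (auto simp: env_update)
  let ?h2 = "?h1(Denominator := h2)"
  obtain h3 where 3: "big N ?I (read_number Code_Length Todo) (lift (env ?o c d 0 False 0), ?h2, [])
      (lift (env ?o c d n False 0), ?h2(Code_Length := h3), [])"
    using big_read_number[of ?I Code_Length n ?h2 Y N "env ?o c d 0 False 0" Todo "[]"] Y le
    by (auto simp: env_update)
  obtain h4 where 4: "big N ?I read_point (lift (env ?o c d n False 0), ?h2(Code_Length := h3), [])
      (lift (env (s (Suc j)) c d n False 0), h4, [])"
    using big_read_point[of ?I eb xb "?h2(Code_Length := h3)" j Y N c d n "[]"] q Y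
    unfolding s_def by auto
  obtain r where 5: "big N ?I (While (Pos (Var Todo)) one_round) (lift (env (s (Suc j)) c d n False 0), h4, [])
      (r, h4, code c d (s (Suc j)) n)"
    using big_rounds[OF Y(1,2) le(1), of n ?I h4] le by auto
  show ?thesis
    unfolding tent_program_def 0
    using big.Seq[OF 1 big.Seq[OF 2 big.Seq[OF 3 big.Seq[OF 4 5]]]] by blast
qed

section \<open>Correctness and space bound\<close>

text \<open>The upper bound is not strict, since an expansion may consist of ones from some position
  on.\<close>

lemma binary_expansion_prefix:
  assumes "binary_expansion x b"
  shows "real (prefix b q) / 2 ^ q \<le> x" "x \<le> (real (prefix b q) + 1) / 2 ^ q"
proof -
  let ?f = "\<lambda>i. of_bool (b i) / 2 ^ Suc i :: real"
  have f: "?f sums x" using assms by (simp add: binary_expansion_def)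
  have part: "(\<Sum>i<n. ?f i) = real (prefix b n) / 2 ^ n" for n
    by (induction n) (auto simp: field_simps)
  have "(\<Sum>i<q. ?f i) \<le> suminf ?f"
    by (intro sum_le_suminf) (use f in \<open>auto dest: sums_summable\<close>)
  then show "real (prefix b q) / 2 ^ q \<le> x"
    unfolding part sums_unique[OF f, symmetric] .
  \<comment> \<open>After doubling \<open>k\<close> times, the further bits add at most
    \<open>2 ^ k - 1\<close>.\<close>
  have le: "prefix b (q + k) + 1 \<le> (prefix b q + 1) * 2 ^ k" for k
    by (induction k) (auto simp: of_bool_def)
  have "(\<Sum>i<q + k. ?f i) \<le> (real (prefix b q) + 1) / 2 ^ q" for k
  proof -
    have "real (prefix b (q + k)) \<le> (real (prefix b q) + 1) * 2 ^ k"
      using of_nat_mono[OF le[of k], where 'a = real] by (simp add: distrib_right)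
    then show ?thesis unfolding part by (simp add: power_add field_simps)
  qed
  moreover have "(\<lambda>k. \<Sum>i<q + k. ?f i) \<longlonglongrightarrow> x"
    using LIMSEQ_ignore_initial_segment[OF f[unfolded sums_def], of q] by (simp add: add.commute)
  ultimately show "x \<le> (real (prefix b q) + 1) / 2 ^ q"
    by (intro LIMSEQ_le_const2) auto
qed

lemma binary_expansion_leading:
  assumes "binary_expansion x b" "0 < x"
  obtains j where "\<And>i. i < j \<Longrightarrow> \<not> b i" "b j" "1 / 2 ^ Suc j \<le> x" "x \<le> 1 / 2 ^ j"
proof -
  have "\<exists>j. b j"
  proof (rule ccontr)
    assume "\<not> ?thesis"
    then have "(\<lambda>i. 0) sums x" using assms(1) by (simp add: binary_expansion_def)
    then show False using sums_unique2[OF sums_zero] assms(2) by force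
  qed
  define j where "j = (LEAST j. b j)"
  have j: "b j" "\<And>i. i < j \<Longrightarrow> \<not> b i"
    using \<open>\<exists>j. b j\<close> by (auto simp: j_def intro: LeastI_ex dest: not_less_Least)
  have "prefix b i = 0" if "i \<le> j" for i
    using that j(2) by (induction i) auto
  then have "prefix b j = 0" "prefix b (Suc j) = 1" using j(1) by auto
  then show thesis
    using that[OF j(2,1)] binary_expansion_prefix(1)[OF assms(1), of "Suc j"]
      binary_expansion_prefix(2)[OF assms(1), of j] by simp
qed

context slope
begin

lemma walk_invariant:
  assumes "sound J [] s" "frugal q s"
  shows "sound J (code c d s t) ((advance c d ^^ t) s) \<and> frugal q ((advance c d ^^ t) s)"
proof (induction t)
  case 0
  show ?case using assms by simp
next
  case (Suc t)
  then show ?case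
    unfolding funpow.simps comp_apply code.simps using sound_advance frugal_advance by blast
qed

lemma start_invariant:
  fixes X q :: nat
  assumes "X < 2 ^ q"
  defines "s \<equiv> (2 * X, 2 * X + 2, 2 ^ q, 2 ^ q - 1, 2 ^ q)"
  shows "sound {real X / 2 ^ q<..<(real X + 1) / 2 ^ q} [] s" "frugal q s"
proof -
  have r: "ratio (2 * X) (2 ^ q) = real X / 2 ^ q" "ratio (2 * X + 2) (2 ^ q) = (real X + 1) / 2 ^ q"
    by (simp_all add: ratio_def field_simps)
  have lt: "real X / 2 ^ q < (real X + 1) / 2 ^ q" by (simp add: divide_strict_right_mono)
  have "image_of \<mu> J [] = J" for J
    by (auto simp: image_of_def tent_code_def)
  then show "sound {real X / 2 ^ q<..<(real X + 1) / 2 ^ q} [] s"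
    unfolding s_def sound.simps r using assms(1) lt by (simp add: segment_def)
  have "\<bar>real X / 2 ^ q - (real X + 1) / 2 ^ q\<bar> = \<mu> ^ 0 / 2 ^ q"
    by (simp add: diff_divide_distrib[symmetric])
  then show "frugal q s"
    unfolding s_def frugal.simps r by (intro disjI1 exI[of _ 0]) simp
qed

text \<open>The ends differ, so the open segment contains its midpoint. Pulling this back gives a
  point with the emitted code, which the program itself never computes.\<close>

lemma code_in_image:
  assumes "sound J w s"
  shows "\<exists>x\<in>J. tent_code \<mu> (length w) x = w"
proof -
  obtain A Z H W K where s: "s = (A, Z, H, W, K)" by (metis prod_cases5)
  let ?a = "ratio A H" and ?z = "ratio Z H"
  have inv: "0 < H" "A \<noteq> Z" "segment ?a ?z \<subseteq> image_of \<mu> J w"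
    using assms by (auto simp: s)
  have "?a \<noteq> ?z" using inv by (auto simp: ratio_def)
  then have "(?a + ?z) / 2 \<in> segment ?a ?z" by (auto simp: segment_def min_def max_def)
  then show ?thesis using inv(3) image_of_nonempty by blast
qed

end

lemma length_code [simp]: "length (code c d s t) = t"
  by (induction t) auto

lemma outputs_in_space_mono:
  "outputs_in_space M I bs s \<Longrightarrow> s \<le> s' \<Longrightarrow> outputs_in_space M I bs s'"
  unfolding outputs_in_space_def by (intro conjI; blast intro: order_trans)

text \<open>\<open>L\<close>, \<open>u\<close>, \<open>D\<close>, \<open>G\<close> stand for the
  binary logarithms of \<open>1/\<epsilon>\<close>, \<mu>, \<open>d\<close>, \<open>n\<close>. As
  \<open>L \<ge> 2\<close>, \<open>D \<ge> 1\<close> and \<open>1 / u \<ge> 1\<close>, every term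
  other than \<open>G\<close> is dominated by \<open>m = L\<^sup>2 * D / u\<^sup>2\<close>,
  constants included by \<open>4 \<le> m\<close>. The left side comes out below
  \<open>81 * m + 10 * G\<close>; 200 is a round number above that.\<close>

lemma space_estimate:
  fixes L u D G q e :: real
  assumes "2 \<le> L" "0 < u" "u < 1" "1 \<le> D" "0 \<le> G" "q \<le> L + 1"
    and e: "e \<le> 2 / (u * ln 2)\<^sup>2 + (q + 1) / (u * ln 2)"
  shows "10 * (2 + D + G + q + e * D) + 3 \<le> 200 * (L\<^sup>2 * D / u\<^sup>2 + G)"
proof -
  define m where "m = L\<^sup>2 * D / u\<^sup>2"
  define v where "v = 1 / u"
  have v: "1 \<le> v" using assms by (simp add: v_def)
  have M: "m = L\<^sup>2 * D * v\<^sup>2" by (simp add: m_def v_def power_divide)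
  have ln2: "1/2 \<le> ln (2::real)" using ln_le_minus_one[of "1 / 2 :: real"] by (simp add: ln_div)
  have l: "1 / (u * ln 2) \<le> 2 * v"
    using ln2 assms(2) by (simp add: v_def field_simps)
  have lp: "0 < 1 / (u * ln 2)" using assms(2) by simp
  have "(1 / (u * ln 2))\<^sup>2 \<le> (2 * v)\<^sup>2" using l lp by (intro power_mono) auto
  then have "2 / (u * ln 2)\<^sup>2 \<le> 8 * v\<^sup>2" by (simp add: power_divide power_mult_distrib)
  moreover have "(q + 1) / (u * ln 2) \<le> (2 * L) * (2 * v)"
  proof -
    have "(q + 1) * (1 / (u * ln 2)) \<le> (2 * L) * (1 / (u * ln 2))"
      using assms lp by (intro mult_right_mono) auto
    also have "\<dots> \<le> (2 * L) * (2 * v)" using l assms by (intro mult_left_mono) auto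
    finally show ?thesis by simp
  qed
  ultimately have e': "e \<le> 8 * v\<^sup>2 + 4 * L * v" using e by linarith
  have vv: "v \<le> v\<^sup>2" "1 \<le> v\<^sup>2" using v mult_mono[of 1 v 1 v] by (auto simp: power2_eq_square)
  have LL: "4 \<le> L\<^sup>2" "L \<le> L\<^sup>2" using assms(1) power_mono[of 2 L 2] by (auto simp: power2_eq_square)
  have Dv: "1 \<le> D * v\<^sup>2" using mult_mono[of 1 D 1 "v\<^sup>2"] vv assms by simp
  have "4 * (D * v\<^sup>2) \<le> L\<^sup>2 * (D * v\<^sup>2)" using LL Dv by (intro mult_right_mono) auto
  then have 1: "4 * (D * v\<^sup>2) \<le> m" unfolding M by (simp add: mult.assoc)
  have "D * 1 \<le> D * v\<^sup>2" using vv assms by (intro mult_left_mono) auto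
  then have 2: "4 * D \<le> m" using 1 by linarith
  have "L * 1 \<le> L\<^sup>2 * (D * v\<^sup>2)" using LL Dv assms by (intro mult_mono) auto
  then have 3: "L \<le> m" unfolding M by (simp add: mult.assoc)
  have "L * (v * D) \<le> L\<^sup>2 * (v\<^sup>2 * D)" using LL vv v assms by (intro mult_mono mult_right_mono mult_nonneg_nonneg) auto
  then have 4: "L * v * D \<le> m" unfolding M by (simp add: mult_ac)
  have "e * D \<le> (8 * v\<^sup>2 + 4 * L * v) * D" using e' assms by (intro mult_right_mono) auto
  also have "\<dots> = 8 * (D * v\<^sup>2) + 4 * (L * v * D)" by (simp add: algebra_simps)
  finally have "e * D \<le> 6 * m" using 1 4 by argo
  moreover have "4 \<le> m" using 1 Dv by linarith
  ultimately show ?thesis using 2 3 assms unfolding m_def[symmetric] by argo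
qed

theorem theorem1:
  shows "\<exists>(M :: (nat, nat) tm) (K :: real). wf_tm M \<and>
    (\<forall>(c :: nat) (d :: nat) (\<mu> :: real) (\<epsilon> :: real) (eb :: nat \<Rightarrow> bool).
       coprime c d \<and> d > 0 \<and> \<mu> = real c / real d \<and> 1 < \<mu> \<and> \<mu> < 2 \<and>
       0 < \<epsilon> \<and> \<epsilon> < 1/4 \<and> binary_expansion \<epsilon> eb \<longrightarrow>
       (\<forall>(n :: nat) (x :: real) (xb :: nat \<Rightarrow> bool).
          n > 0 \<and> x \<in> {0..<1} \<and> binary_expansion x xb \<longrightarrow>
          (\<exists>bs \<in> tent_language_near \<mu> n x \<epsilon>.
             outputs_in_space M (input_tapes c d n eb xb) bs
               (K * ((log 2 (1/\<epsilon>))\<^sup>2 * log 2 (real d) / (log 2 \<mu>)\<^sup>2 + log 2 (real n))))))"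
proof -
  \<comment> \<open>One machine serves all slopes and accuracies, so it is fixed before any
    input.\<close>
  obtain M :: "(nat, nat) tm" where wf: "wf_tm M" and
    M: "\<And>I bs s. outputs_in_space (machine tent_program) I bs s \<Longrightarrow> outputs_in_space M I bs s"
    using nat_tm[OF wf_machine[of tent_program]] by blast
  have "\<exists>bs \<in> tent_language_near \<mu> n x \<epsilon>.
      outputs_in_space M (input_tapes c d n eb xb) bs
        (200 * ((log 2 (1/\<epsilon>))\<^sup>2 * log 2 (real d) / (log 2 \<mu>)\<^sup>2 + log 2 (real n)))"
    if asm: "d > 0" "\<mu> = real c / real d" "1 < \<mu>" "\<mu> < 2" and eps: "0 < \<epsilon>" "\<epsilon> < 1/4" "binary_expansion \<epsilon> eb"
      and n: "n > 0" and x: "x \<in> {0..<1}" "binary_expansion x xb"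
    for c d n :: nat and \<mu> \<epsilon> x :: real and eb xb :: "nat \<Rightarrow> bool"
  proof -
    interpret slope c d \<mu> by unfold_locales (use asm in auto)
    obtain j where j: "\<And>i. i < j \<Longrightarrow> \<not> eb i" "eb j" and ej: "1 / 2 ^ Suc j \<le> \<epsilon>" "\<epsilon> \<le> 1 / 2 ^ j"
      using binary_expansion_leading[OF eps(3,1)] by blast
    define q where "q = Suc j"
    define X where "X = prefix xb q"
    define s :: walk where "s = (2 * X, 2 * X + 2, 2 ^ q, 2 ^ q - 1, 2 ^ q :: nat)"
    define J where "J = {real X / 2 ^ q<..<(real X + 1) / 2 ^ q}"
    have X: "X < 2 ^ q" unfolding X_def by (rule prefix_less)
    have inv: "sound J (code c d s t) ((advance c d ^^ t) s)" "frugal q ((advance c d ^^ t) s)" for t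
      using walk_invariant[OF start_invariant[OF X]] by (auto simp: J_def s_def)
    have mem: "code c d s n \<in> tent_language_near \<mu> n x \<epsilon>"
    proof -
      obtain y where y: "y \<in> J" "tent_code \<mu> n y = code c d s n"
        using code_in_image[OF inv(1)[of n]] by auto
      have xq: "real X / 2 ^ q \<le> x" "x \<le> (real X + 1) / 2 ^ q"
        using binary_expansion_prefix[OF x(2), of q] by (simp_all add: X_def)
      have yq: "real X / 2 ^ q < y" "y < (real X + 1) / 2 ^ q" using y(1) by (auto simp: J_def)
      have "(real X + 1) / 2 ^ q = real X / 2 ^ q + 1 / 2 ^ q" by (simp add: add_divide_distrib)
      \<comment> \<open>\<open>x\<close> lies in the closure of \<open>J\<close>, possibly at an
        end, and \<open>J\<close> has length \<open>1 / 2 ^ q \<le> \<epsilon>\<close>.\<close>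
      then have "x - \<epsilon> \<le> y" "y \<le> x + \<epsilon>" using xq yq ej(1) unfolding q_def by linarith+
      moreover have "real X + 1 \<le> 2 ^ q" using X by (metis Suc_leI of_nat_Suc of_nat_le_iff of_nat_numeral of_nat_power add.commute)
      then have "(real X + 1) / 2 ^ q \<le> 1" by simp
      then have "y < 1" using yq by linarith
      moreover have "0 \<le> real X / 2 ^ q" by simp
      then have "0 \<le> y" using yq by linarith
      ultimately show ?thesis
        unfolding tent_language_near_def by (intro CollectI exI[of _ y]) (auto simp: y)
    qed
    define E where "E = 2 / (ln \<mu>)\<^sup>2 + (real q + 1) / ln \<mu>"
    define e where "e = nat \<lfloor>E\<rfloor>"
    \<comment> \<open>For \<open>d = 1\<close> the slope would be an integer strictly between 1 and
      2. This makes the logarithm of \<open>d\<close> at least 1, as the final estimate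
      requires.\<close>
    have d2: "2 \<le> d"
    proof (rule ccontr)
      assume "\<not> ?thesis"
      then have "d = 1" using asm(1) by linarith
      then show False using asm by simp
    qed
    define B where "B = 2 ^ q * d ^ e"
    \<comment> \<open>\<open>B\<close> bounds all scales of the walk and its ends are at most
      \<open>2 * B\<close>. As a product with \<open>d\<close> and \<open>n\<close>,
      \<open>Y\<close> also exceeds the other inputs, and its logarithm splits into the terms of the
      space bound.\<close>
    define Y where "Y = 4 * d * n * B"
    have B: "2 ^ q \<le> B" "0 < B" using asm(1) by (auto simp: B_def)
    have Y: "4 * B \<le> Y" "4 * d \<le> Y" "4 * n \<le> Y"
    proof -
      have "1 * 1 \<le> d * n" "1 * 1 \<le> n * B" "1 * 1 \<le> d * B"
        using n asm(1) B by (intro mult_le_mono; simp)+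
      then have "B * 1 \<le> B * (d * n)" "d * 1 \<le> d * (n * B)" "n * 1 \<le> n * (d * B)"
        by (intro mult_le_mono; simp)+
      then show "4 * B \<le> Y" "4 * d \<le> Y" "4 * n \<le> Y" by (simp_all add: Y_def mult_ac)
    qed
    have walk: "walk_le Y ((advance c d ^^ t) s)" for t
    proof -
      obtain A Z H W K where t: "(advance c d ^^ t) s = (A, Z, H, W, K)" by (metis prod_cases5)
      note i = inv[of t, unfolded t]
      obtain k where k: "H = 2 ^ q * d ^ k" "real k \<le> E" and "K \<le> H"
        using frugal_bound[OF i] by (auto simp: E_def)
      have "k \<le> e" using k(2) by (simp add: e_def le_nat_floor)
      then have "H \<le> B" using k(1) asm(1) by (simp add: B_def power_increasing)
      then show ?thesis using i(1) \<open>K \<le> H\<close> Y(1) by (simp add: t)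
    qed
    \<comment> \<open>The added one makes \<open>Y ^ 10 < 2 ^ b\<close> strict, as
      \<open>machine_outputs\<close> requires.\<close>
    define b where "b = nat \<lceil>10 * log 2 (real Y)\<rceil> + 1"
    have Ypos: "0 < real Y" using Y B by simp
    have "real (Y ^ 10) < 2 ^ b"
    proof -
      have "10 * log 2 (real Y) < real b" by (simp add: b_def) linarith
      then have "log 2 (real Y ^ 10) < real b" using Ypos by (simp add: log_nat_power)
      then show ?thesis using Ypos by (simp add: log_less_iff powr_realpow)
    qed
    then have N: "Y ^ 10 < 2 ^ b" by (metis of_nat_less_iff of_nat_numeral of_nat_power)
    have "2 * 2 ^ Suc j \<le> Y" using Y(1) B(1) by (simp add: q_def)
    moreover have "2 \<le> Y" using Y(2) asm(1) by linarith
    moreover have "c < Y" using c_le Y(2) asm(1) by linarith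
    moreover have "d < Y" "n < Y" using Y n asm(1) by linarith+
    moreover have "walk_le Y ((advance c d ^^ t) (2 * prefix xb (Suc j), 2 * prefix xb (Suc j) + 2, 2 ^ Suc j, 2 ^ Suc j - 1, 2 ^ Suc j))" for t
      using walk[of t] by (simp only: s_def X_def q_def)
    ultimately obtain r hs where
      "big (Y ^ 10) (input_tapes c d n eb xb) tent_program (\<lambda>_. 0, \<lambda>_. 0, []) (r, hs, code c d s n)"
      using big_tent_program[of j eb Y "Y ^ 10" c d xb n] j unfolding s_def X_def q_def by blast
    then have out: "outputs_in_space M (input_tapes c d n eb xb) (code c d s n) (real (Suc b))"
      using M machine_outputs N by blast
    let ?L = "log 2 (1/\<epsilon>)" and ?u = "log 2 \<mu>" and ?D = "log 2 (real d)" and ?G = "log 2 (real n)"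
    have "real (Suc b) \<le> 200 * (?L\<^sup>2 * ?D / ?u\<^sup>2 + ?G)"
    proof -
      have L: "2 \<le> ?L" using eps by (simp add: le_log_iff powr_numeral field_simps)
      have u: "0 < ?u" "?u < 1" using asm by (auto simp: log_less_iff)
      have D: "1 \<le> ?D" using d2 by (simp add: le_log_iff)
      have G: "0 \<le> ?G" using n by simp
      have "real j \<le> ?L"
      proof -
        have "2 ^ j \<le> 1 / \<epsilon>" using ej(2) eps by (simp add: field_simps)
        then show ?thesis using eps by (simp add: le_log_iff powr_realpow)
      qed
      then have q: "real q \<le> ?L + 1" by (simp add: q_def)
      have ln: "ln \<mu> = ?u * ln 2" by (simp add: log_def)
      have "0 \<le> E" using asm by (simp add: E_def)
      then have "real e \<le> E" by (simp add: e_def)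
      then have e: "real e \<le> 2 / (?u * ln 2)\<^sup>2 + (real q + 1) / (?u * ln 2)" by (simp add: E_def ln)
      have "log 2 (real Y) = 2 + ?D + ?G + real q + real e * ?D"
      proof -
        have "log 2 (4::real) = log 2 (2 ^ 2)" by simp
        then have "log 2 (4::real) = 2" by (simp only: log_pow_cancel)
        then show ?thesis using asm(1) n by (simp add: Y_def B_def log_mult log_nat_power)
      qed
      moreover have "real (Suc b) \<le> 10 * log 2 (real Y) + 3"
      proof -
        have "1 \<le> real Y" using Ypos by simp
        then have "0 \<le> log 2 (real Y)" by simp
        then show ?thesis by (simp add: b_def) linarith
      qed
      ultimately show ?thesis using space_estimate[OF L u D G q e] by simp
    qed
    then show ?thesis using mem out outputs_in_space_mono by blast
  qed
  then show ?thesis using wf by (intro exI[of _ M] exI[of _ 200]) blast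
qed

end
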